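(* There exist constants $C_0,C_1,C_2>0$ depending on $\rho_0^\pm,P_\pm,g,m,\ell$ such that the eigenvalue $\lambda=\lambda(|\xi|)$ satisfies $$\lambda^2(|\xi|)\ge C_1|\xi|-C_2\quad\text{for }|\xi|\ge C_0.$$
   Context: **Steady state.** $g,m,\ell>0$. $P_\pm\in C^\infty((0,\infty))$ are nonnegative and strictly increasing with $1/P_\pm'\in L^\infty_{loc}((0,\infty))$, and $h_\pm(z)=\int_1^z \frac{P_\pm'(r)}{r}dr$. The number $\rho_0^->0$ satisfies $P_-(\rho_0^-)>P_+(\rho_0^-)$ and $P_-(\rho_0^-)\in P_+((0,\infty))$; $\rho_0^+:=P_+^{-1}(P_-(\rho_0^-))$, so $\rho_0^+>\rho_0^-$. It is assumed that $h_-(\rho_0^-)+gm\in h_-((0,\infty))$ and $h_+(\rho_0^+)-g\ell\in h_+((0,\infty))$. Define $\rho_0(x_3)=h_-^{-1}(h_-(\rho_0^-)-gx_3)$ for $-m<x_3<0$ and $\rho_0(x_3)=h_+^{-1}(h_+(\rho_0^+)-gx_3)$ for $0<x_3<\ell$. $P'(\rho_0)$ means $P_+'(\rho_0)$ for $x_3>0$ and $P_-'(\rho_0)$ for $x_3<0$. **Eigenvalue.** For $|\xi|>0$ and real-valued $(\varphi,\psi)\in L^2((-m,\ell))\times H_0^1((-m,\ell))$ (usual Sobolev space), let $E(\varphi,\psi)=\frac12\int_{-m}^\ell P'(\rho_0)\rho_0(\psi'+|\xi|\varphi)^2-2g\rho_0|\xi|\psi\varphi$, $J(\varphi,\psi)=\frac12\int_{-m}^\ell\rho_0(\varphi^2+\psi^2)$,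 and $\mathcal{A}=\{(\varphi,\psi):J(\varphi,\psi)=1\}$. The infimum of $E$ over $\mathcal{A}$ is known to be negative and finite, and $\lambda(|\xi|)>0$ is defined by $-\lambda^2(|\xi|)=\inf_{\mathcal{A}}E$. *)

theory Defs
  imports "HOL-Analysis.Analysis"
begin

text \<open>Intended for open \<open>S\<close>, where \<open>differentiable_on\<close> makes the iterates of \<^const>\<open>deriv\<close>
  the actual derivatives on \<open>S\<close>.\<close>

definition C_infinity_on :: "real set \<Rightarrow> (real \<Rightarrow> real) \<Rightarrow> bool" where
  "C_infinity_on S f \<longleftrightarrow> (\<forall>n. (deriv ^^ n) f differentiable_on S)"

definition Linfty_loc :: "real set \<Rightarrow> (real \<Rightarrow> real) set" where
  "Linfty_loc S = {f \<in> borel_measurable (lebesgue_on S).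
     \<forall>K. compact K \<and> K \<subseteq> S \<longrightarrow> (\<exists>C. AE x in lebesgue_on K. \<bar>f x\<bar> \<le> C)}"

definition L1_loc :: "real set \<Rightarrow> (real \<Rightarrow> real) set" where
  "L1_loc S = {f \<in> borel_measurable (lebesgue_on S).
     \<forall>K. compact K \<and> K \<subseteq> S \<longrightarrow> integrable (lebesgue_on K) f}"

text \<open>Elements of the following spaces are representatives, not classes modulo null sets.\<close>

definition L2 :: "real set \<Rightarrow> (real \<Rightarrow> real) set" where
  "L2 S = {f \<in> borel_measurable (lebesgue_on S). integrable (lebesgue_on S) (\<lambda>x. (f x)\<^sup>2)}"

definition test_functions :: "real set \<Rightarrow> (real \<Rightarrow> real) set" where
  "test_functions S = {\<eta>. C_infinity_on UNIV \<eta> \<and>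
     compact (closure {x. \<eta> x \<noteq> 0}) \<and> closure {x. \<eta> x \<noteq> 0} \<subseteq> S}"

definition has_weak_deriv :: "real set \<Rightarrow> (real \<Rightarrow> real) \<Rightarrow> (real \<Rightarrow> real) \<Rightarrow> bool" where
  "has_weak_deriv S u v \<longleftrightarrow> u \<in> L1_loc S \<and> v \<in> L1_loc S \<and>
     (\<forall>\<eta> \<in> test_functions S.
        (LINT x|lebesgue_on S. u x * deriv \<eta> x) = - (LINT x|lebesgue_on S. v x * \<eta> x))"

text \<open>Determined only up to a null set; it is used only under integrals.\<close>

definition weak_deriv :: "real set \<Rightarrow> (real \<Rightarrow> real) \<Rightarrow> real \<Rightarrow> real" where
  "weak_deriv S u = (SOME v. has_weak_deriv S u v)"

definition H1 :: "real set \<Rightarrow> (real \<Rightarrow> real) set" where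
  "H1 S = {u \<in> L2 S. \<exists>v \<in> L2 S. has_weak_deriv S u v}"

text \<open>The closure of the test functions in the \<open>H1\<close> norm.\<close>

definition H1_0 :: "real set \<Rightarrow> (real \<Rightarrow> real) set" where
  "H1_0 S = {u \<in> H1 S. \<exists>\<eta>. (\<forall>n::nat. \<eta> n \<in> test_functions S) \<and>
     (\<lambda>n. LINT x|lebesgue_on S. (\<eta> n x - u x)\<^sup>2 + (deriv (\<eta> n) x - weak_deriv S u x)\<^sup>2)
       \<longlonglongrightarrow> 0}"

text \<open>The almost-everywhere condition says that \<open>1 / P'\<close> is defined as an element of
  \<open>Linfty_loc\<close>, independently of the convention \<open>1 / 0 = 0\<close>.\<close>

definition pressure_law :: "(real \<Rightarrow> real) \<Rightarrow> bool" where
  "pressure_law P \<longleftrightarrow> C_infinity_on {0<..} P \<and> (\<forall>z>0. P z \<ge> 0) \<and> strict_mono_on {0<..} P \<and>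
     (AE z in lebesgue_on {0<..}. deriv P z \<noteq> 0) \<and>
     (\<lambda>z. 1 / deriv P z) \<in> Linfty_loc {0<..}"

text \<open>The integral is oriented: the value is negative for \<open>z < 1\<close>.\<close>

definition enthalpy :: "(real \<Rightarrow> real) \<Rightarrow> real \<Rightarrow> real" where
  "enthalpy P z = (LBINT r=1..ereal z. deriv P r / r)"

text \<open>Throughout, \<open>Pm\<close>, \<open>Pp\<close> are the laws of the lower and upper fluid and \<open>rm\<close> is the
  lower density \<open>\<rho>\<^sub>0\<^sup>-\<close> at the interface.\<close>

definition rho_plus :: "(real \<Rightarrow> real) \<Rightarrow> (real \<Rightarrow> real) \<Rightarrow> real \<Rightarrow> real" where
  "rho_plus Pm Pp rm = inv_into {0<..} Pp (Pm rm)"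

definition rho0 :: "(real \<Rightarrow> real) \<Rightarrow> (real \<Rightarrow> real) \<Rightarrow> real \<Rightarrow> real \<Rightarrow> real \<Rightarrow> real" where
  "rho0 Pm Pp g rm x =
     (if x < 0 then inv_into {0<..} (enthalpy Pm) (enthalpy Pm rm - g * x)
      else inv_into {0<..} (enthalpy Pp) (enthalpy Pp (rho_plus Pm Pp rm) - g * x))"

definition dP_rho0 :: "(real \<Rightarrow> real) \<Rightarrow> (real \<Rightarrow> real) \<Rightarrow> real \<Rightarrow> real \<Rightarrow> real \<Rightarrow> real" where
  "dP_rho0 Pm Pp g rm x =
     (if x < 0 then deriv Pm (rho0 Pm Pp g rm x) else deriv Pp (rho0 Pm Pp g rm x))"

definition energy_E ::
  "(real \<Rightarrow> real) \<Rightarrow> (real \<Rightarrow> real) \<Rightarrow> real \<Rightarrow> real \<Rightarrow> real \<Rightarrow> real \<Rightarrow> real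
   \<Rightarrow> (real \<Rightarrow> real) \<Rightarrow> (real \<Rightarrow> real) \<Rightarrow> real" where
  "energy_E Pm Pp g m l rm k \<phi> \<psi> =
     1/2 * (LINT x|lebesgue_on {-m<..<l}.
        dP_rho0 Pm Pp g rm x * rho0 Pm Pp g rm x * (weak_deriv {-m<..<l} \<psi> x + k * \<phi> x)\<^sup>2
        - 2 * g * rho0 Pm Pp g rm x * k * \<psi> x * \<phi> x)"

definition energy_J ::
  "(real \<Rightarrow> real) \<Rightarrow> (real \<Rightarrow> real) \<Rightarrow> real \<Rightarrow> real \<Rightarrow> real \<Rightarrow> real
   \<Rightarrow> (real \<Rightarrow> real) \<Rightarrow> (real \<Rightarrow> real) \<Rightarrow> real" where
  "energy_J Pm Pp g m l rm \<phi> \<psi> =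
     1/2 * (LINT x|lebesgue_on {-m<..<l}. rho0 Pm Pp g rm x * ((\<phi> x)\<^sup>2 + (\<psi> x)\<^sup>2))"

definition admissible ::
  "(real \<Rightarrow> real) \<Rightarrow> (real \<Rightarrow> real) \<Rightarrow> real \<Rightarrow> real \<Rightarrow> real \<Rightarrow> real
   \<Rightarrow> ((real \<Rightarrow> real) \<times> (real \<Rightarrow> real)) set" where
  "admissible Pm Pp g m l rm =
     {(\<phi>, \<psi>). \<phi> \<in> L2 {-m<..<l} \<and> \<psi> \<in> H1_0 {-m<..<l} \<and> energy_J Pm Pp g m l rm \<phi> \<psi> = 1}"

text \<open>\<open>k\<close> stands for \<open>\<bar>\<xi>\<bar> > 0\<close>. The infimum is taken in the reals, so it is meaningful only
  because \<open>E\<close> is bounded below on the nonempty admissible set.\<close>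

definition eigenvalue ::
  "(real \<Rightarrow> real) \<Rightarrow> (real \<Rightarrow> real) \<Rightarrow> real \<Rightarrow> real \<Rightarrow> real \<Rightarrow> real \<Rightarrow> real \<Rightarrow> real" where
  "eigenvalue Pm Pp g m l rm k =
     (THE lam. lam > 0 \<and>
        - lam\<^sup>2 = (INF (\<phi>, \<psi>) \<in> admissible Pm Pp g m l rm. energy_E Pm Pp g m l rm k \<phi> \<psi>))"

end

theory Submission
  imports Defs
begin

text \<open>
  Take a smooth even bump \<open>\<chi>\<close> supported in \<open>[-1, 1]\<close> and decreasing on \<open>[0, 1]\<close>, and set \<open>\<psi> x = \<chi> (k x)\<close>,
  \<open>\<phi> = - \<psi>' / k\<close>. The square in \<open>E\<close> vanishes, leaving \<open>E = g \<integral> \<rho>\<^sub>0 \<psi> \<psi>'\<close>. Since \<open>\<psi> \<psi>' = (\<psi>\<^sup>2)' / 2\<close> is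
  nonnegative below the interface and nonpositive above it, and \<open>\<rho>\<^sub>0\<close> is close to its one-sided limits
  \<open>\<rho>\<^sub>0\<^sup>- < \<rho>\<^sub>0\<^sup>+\<close> on the support of \<open>\<psi>\<close> for large \<open>k\<close>, \<open>E\<close> is at most a negative constant independent of \<open>k\<close>,
  whereas \<open>J\<close> is at most a constant times \<open>1 / k\<close>. Normalising to \<open>J = 1\<close> gives \<open>inf E \<le> - C\<^sub>1 k\<close>. Conversely
  \<open>E \<ge> - g k J\<close> always, so the infimum is finite and negative and \<open>\<lambda>\<^sup>2 = - inf E\<close>.
\<close>

section \<open>Smooth bump functions\<close>

text \<open>With \<open>p = 1\<close> this is the classical smooth function
  \<open>exp (- 1 / x)\<close> extended by zero. The polynomial factor makes the family closed under
  differentiation.\<close>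

definition flat :: "real poly \<Rightarrow> real \<Rightarrow> real" where
  "flat p x = (if x > 0 then poly p (1 / x) * exp (- (1 / x)) else 0)"

text \<open>The power \<open>y ^ k\<close> is carried along so that the induction hypothesis absorbs
  the factor \<open>y\<close> that \<open>pCons\<close> puts in front of the remaining
  polynomial.\<close>

lemma poly_div_exp_tendsto_0:
  fixes p :: "real poly"
  shows "((\<lambda>y. y ^ k * poly p y / exp y) \<longlongrightarrow> 0) at_top"
proof (induction p arbitrary: k)
  case 0
  then show ?case by simp
next
  case (pCons a p)
  have "((\<lambda>y. a * (y ^ k / exp y) + y ^ Suc k * poly p y / exp y) \<longlongrightarrow> a * 0 + 0) at_top"
    by (intro tendsto_intros tendsto_power_div_exp_0 pCons)
  then show ?case
    by (simp add: field_simps)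
qed

text \<open>In the variable \<open>y = 1 / x\<close> one has \<open>d/dx = - y\<^sup>2 d/dy\<close>.\<close>

lemma flat_has_derivative:
  "(flat p has_real_derivative flat (monom 1 2 * (p - pderiv p)) x) (at x)"
proof -
  consider "x < 0" | "x > 0" | "x = 0" by linarith
  then show ?thesis
  proof cases
    case 1
    have "((\<lambda>_. 0) has_real_derivative 0) (at x)" by simp
    moreover have "eventually (\<lambda>y. flat p y = 0) (nhds x)"
      by (rule eventually_mono[OF eventually_nhds_in_open[of "{..<0}"]]) (use 1 in \<open>auto simp: flat_def\<close>)
    ultimately have "(flat p has_real_derivative 0) (at x)"
      by (simp add: DERIV_cong_ev)
    then show ?thesis
      using 1 by (simp add: flat_def)
  next
    case 2
    have "((\<lambda>x. poly p (1 / x) * exp (- (1 / x))) has_real_derivative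
        (poly (pderiv p) (1 / x) * (- 1 / x\<^sup>2)) * exp (- (1 / x)) +
        exp (- (1 / x)) * (1 / x\<^sup>2) * poly p (1 / x)) (at x)"
    proof (rule DERIV_cong[OF DERIV_mult[OF DERIV_chain2[OF poly_DERIV] DERIV_chain2[OF DERIV_exp]]])
      show "((\<lambda>x. 1 / x) has_real_derivative - 1 / x\<^sup>2) (at x)"
        "((\<lambda>x. - (1 / x)) has_real_derivative 1 / x\<^sup>2) (at x)"
        using 2 by (auto intro!: derivative_eq_intros simp: power2_eq_square)
    qed simp
    moreover have "eventually (\<lambda>y. flat p y = poly p (1 / y) * exp (- (1 / y))) (nhds x)"
      by (rule eventually_mono[OF eventually_nhds_in_open[of "{0<..}"]]) (use 2 in \<open>auto simp: flat_def\<close>)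
    ultimately have "(flat p has_real_derivative
        (poly (pderiv p) (1 / x) * (- 1 / x\<^sup>2)) * exp (- (1 / x)) +
        exp (- (1 / x)) * (1 / x\<^sup>2) * poly p (1 / x)) (at x)"
      by (simp add: DERIV_cong_ev)
    then show ?thesis
      using 2 by (simp add: flat_def poly_monom field_simps)
  next
    case 3
    \<comment> \<open>The two branches meet at 0. The difference quotient is zero on the left; on
      the right the substitution of \<open>1 / y\<close> turns it into
      \<open>y * poly p y / exp y\<close>.\<close>
    have "((\<lambda>y. flat p y / y) \<longlongrightarrow> 0) (at 0)"
    proof (rule filterlim_split_at)
      show "((\<lambda>y. flat p y / y) \<longlongrightarrow> 0) (at_left 0)"
        by (rule tendsto_eventually) (auto simp: flat_def eventually_at_filter)
      have "((\<lambda>y. y ^ 1 * poly p y / exp y) \<longlongrightarrow> 0) at_top"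
        by (rule poly_div_exp_tendsto_0)
      then have "((\<lambda>y. flat p (inverse y) / inverse y) \<longlongrightarrow> 0) at_top"
        by (rule Lim_transform_eventually)
          (auto intro!: eventually_mono[OF eventually_gt_at_top[of 0]]
            simp: flat_def field_simps exp_minus)
      then show "((\<lambda>y. flat p y / y) \<longlongrightarrow> 0) (at_right 0)"
        by (simp add: filterlim_at_right_to_top)
    qed
    then show ?thesis
      using 3 by (simp add: has_field_derivative_iff flat_def)
  qed
qed

text \<open>All iterates of \<open>deriv\<close> stay in \<open>F\<close>, and membership in
  \<open>F\<close> gives differentiability, so no formula for higher derivatives is
  required.\<close>

lemma C_infinity_on_UNIV_I:
  assumes "f \<in> F" and "\<And>f. f \<in> F \<Longrightarrow> \<exists>f'\<in>F. \<forall>x. (f has_real_derivative f' x) (at x)"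
  shows "C_infinity_on UNIV f"
proof -
  have deriv_in: "deriv f \<in> F \<and> f differentiable_on UNIV" if f: "f \<in> F" for f
  proof -
    obtain f' where f': "f' \<in> F" "\<forall>x. (f has_real_derivative f' x) (at x)"
      using assms(2)[OF f] by blast
    then have "deriv f = f'"
      by (auto intro: DERIV_imp_deriv)
    moreover have "f differentiable_on UNIV"
      unfolding differentiable_on_def real_differentiable_def using f'(2) by auto
    ultimately show ?thesis
      using f'(1) by simp
  qed
  have "(deriv ^^ n) f \<in> F" for n
    by (induction n) (auto simp: assms(1) deriv_in)
  then show ?thesis
    unfolding C_infinity_on_def using deriv_in by blast
qed

lemma C_infinity_on_UNIV_D:
  assumes "C_infinity_on UNIV f"
  shows "(f has_real_derivative deriv f x) (at x)" "continuous_on UNIV f" "continuous_on UNIV (deriv f)"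
proof -
  have d: "f differentiable_on UNIV" "deriv f differentiable_on UNIV"
    using assms[unfolded C_infinity_on_def, rule_format, of 0]
      assms[unfolded C_infinity_on_def, rule_format, of 1] by simp_all
  then show "continuous_on UNIV f" "continuous_on UNIV (deriv f)"
    by (simp_all add: differentiable_imp_continuous_on)
  have "f differentiable (at x)"
    using d(1) by (simp add: differentiable_on_def)
  then show "(f has_real_derivative deriv f x) (at x)"
    by (simp add: DERIV_deriv_iff_real_differentiable)
qed

text \<open>This algebra is closed under differentiation by the chain, sum and product rules. Affine
  arguments are included because a hump uses both a shifted and a reflected flat function.\<close>

inductive_set flat_algebra :: "(real \<Rightarrow> real) set" where
  flat: "(\<lambda>x. flat p (a * x + b)) \<in> flat_algebra"
| const: "(\<lambda>x. c) \<in> flat_algebra"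
| add: "f \<in> flat_algebra \<Longrightarrow> g \<in> flat_algebra \<Longrightarrow> (\<lambda>x. f x + g x) \<in> flat_algebra"
| mult: "f \<in> flat_algebra \<Longrightarrow> g \<in> flat_algebra \<Longrightarrow> (\<lambda>x. f x * g x) \<in> flat_algebra"

lemma flat_algebra_has_derivative:
  assumes "f \<in> flat_algebra"
  shows "\<exists>f'\<in>flat_algebra. \<forall>x. (f has_real_derivative f' x) (at x)"
  using assms
proof induction
  case (flat p a b)
  let ?q = "monom 1 2 * (p - pderiv p)"
  have "((\<lambda>x. flat p (a * x + b)) has_real_derivative flat ?q (a * x + b) * a) (at x)" for x
    by (rule DERIV_chain2[OF flat_has_derivative]) (auto intro!: derivative_eq_intros)
  then show ?case
    by (intro bexI[of _ "\<lambda>x. flat ?q (a * x + b) * a"]) (auto intro: flat_algebra.intros)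
next
  case (const c)
  show ?case
    by (intro bexI[of _ "\<lambda>x. 0"]) (auto intro: flat_algebra.intros)
next
  case (add f g)
  then obtain f' g' where "f' \<in> flat_algebra" "g' \<in> flat_algebra"
    "\<And>x. (f has_real_derivative f' x) (at x)" "\<And>x. (g has_real_derivative g' x) (at x)"
    by blast
  then show ?case
    by (intro bexI[of _ "\<lambda>x. f' x + g' x"]) (auto intro: flat_algebra.intros DERIV_add)
next
  case (mult f g)
  then obtain f' g' where "f' \<in> flat_algebra" "g' \<in> flat_algebra"
    "\<And>x. (f has_real_derivative f' x) (at x)" "\<And>x. (g has_real_derivative g' x) (at x)"
    by blast
  then have "(\<lambda>x. f' x * g x + g' x * f x) \<in> flat_algebra"
    and "\<forall>x. ((\<lambda>x. f x * g x) has_real_derivative f' x * g x + g' x * f x) (at x)"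
    using mult.hyps by (auto intro: flat_algebra.intros DERIV_mult)
  then show ?case
    by (intro bexI[of _ "\<lambda>x. f' x * g x + g' x * f x"])
qed

text \<open>For \<open>n > 0\<close> the function is positive exactly on the open interval from
  \<open>c\<close> to \<open>d\<close>, and it increases to the indicator of that interval as
  \<open>n\<close> grows. The same family thus supplies approximate indicators and, with
  \<open>n = 1\<close>, the trial profile.\<close>

definition hump :: "real \<Rightarrow> real \<Rightarrow> real \<Rightarrow> real \<Rightarrow> real" where
  "hump n c d x = flat 1 (n * (x - c)) * flat 1 (n * (d - x))"

lemma flat_1_bounds: "0 \<le> flat 1 x" "flat 1 x \<le> 1"
  by (auto simp: flat_def)

lemma hump_bounds: "0 \<le> hump n c d x" "hump n c d x \<le> 1"
  using mult_mono[OF flat_1_bounds(2) flat_1_bounds(2) _ flat_1_bounds(1)]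
  by (auto simp: hump_def flat_1_bounds)

lemma hump_eq_0:
  assumes "n > 0" "x \<notin> {c<..<d}"
  shows "hump n c d x = 0"
  using assms by (auto simp: hump_def flat_def zero_less_mult_iff)

lemma C_infinity_hump: "C_infinity_on UNIV (\<lambda>x. A * hump n c d x)"
proof (rule C_infinity_on_UNIV_I[of _ flat_algebra])
  have "(\<lambda>x. A * (flat 1 (n * x + - n * c) * flat 1 ((- n) * x + n * d))) \<in> flat_algebra"
    by (intro flat_algebra.intros)
  then show "(\<lambda>x. A * hump n c d x) \<in> flat_algebra"
    by (simp add: hump_def algebra_simps)
qed (rule flat_algebra_has_derivative)

lemma hump_test_function:
  assumes "n > 0" "{c..d} \<subseteq> S"
  shows "(\<lambda>x. A * hump n c d x) \<in> test_functions S"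
proof -
  have "{x. A * hump n c d x \<noteq> 0} \<subseteq> {c..d}"
  proof
    fix x assume "x \<in> {x. A * hump n c d x \<noteq> 0}"
    then have "x \<in> {c<..<d}"
      using hump_eq_0[OF assms(1)] by force
    then show "x \<in> {c..d}" by simp
  qed
  then have "closure {x. A * hump n c d x \<noteq> 0} \<subseteq> {c..d}"
    by (intro closure_minimal) auto
  moreover from this have "compact (closure {x. A * hump n c d x \<noteq> 0})"
    by (meson bounded_closed_interval bounded_subset closed_closure compact_eq_bounded_closed)
  ultimately show ?thesis
    using assms(2) C_infinity_hump by (auto simp: test_functions_def)
qed

lemma hump_tendsto_indicator:
  "(\<lambda>n. hump (real (Suc n)) c d x) \<longlonglongrightarrow> indicator {c<..<d} x"
proof (cases "x \<in> {c<..<d}")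
  case True
  have *: "(\<lambda>n. flat 1 (real (Suc n) * y)) \<longlonglongrightarrow> 1" if "y > 0" for y
  proof -
    have "(\<lambda>n. exp (- (inverse (real (Suc n)) * (1 / y)))) \<longlonglongrightarrow> exp (- (0 * (1 / y)))"
      by (intro tendsto_intros LIMSEQ_inverse_real_of_nat)
    moreover have "flat 1 (real (Suc n) * y) = exp (- (inverse (real (Suc n)) * (1 / y)))" for n
      using that by (simp add: flat_def zero_less_mult_iff inverse_eq_divide del: of_nat_Suc)
    ultimately show ?thesis
      by simp
  qed
  have "(\<lambda>n. hump (real (Suc n)) c d x) \<longlonglongrightarrow> 1 * 1"
    unfolding hump_def using True by (intro tendsto_mult *) auto
  then show ?thesis using True by simp
next
  case False
  then show ?thesis by (simp add: hump_eq_0)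
qed

section \<open>The trial profile and the sign of its derivative\<close>

lemma flat_1_has_derivative:
  "(flat 1 has_real_derivative (if x > 0 then exp (- (1 / x)) / x\<^sup>2 else 0)) (at x)"
  using flat_has_derivative[of 1 x]
  by (cases "x > 0") (simp_all add: flat_def poly_monom power_divide)

abbreviation bump :: "real \<Rightarrow> real" where "bump \<equiv> hump 1 (-1) 1"

lemma bump_smooth: "C_infinity_on UNIV bump"
  using C_infinity_hump[of 1 1 "-1" 1] by simp

lemma bump_eq_0: "\<bar>y\<bar> \<ge> 1 \<Longrightarrow> bump y = 0"
  by (rule hump_eq_0) auto

lemma bump_0_pos: "bump 0 > 0"
  by (simp add: hump_def flat_def)

text \<open>Inside the support the bump is \<open>exp (- 1 / (1 + y) - 1 / (1 - y))\<close>, and the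
  bracket is its logarithmic derivative. In this form the sign of the derivative on either side of 0
  can be read off.\<close>

lemma deriv_bump:
  "deriv bump y = (if \<bar>y\<bar> < 1 then (1 / (1 + y)\<^sup>2 - 1 / (1 - y)\<^sup>2) * bump y else 0)"
proof -
  let ?D = "\<lambda>x::real. if x > 0 then exp (- (1 / x)) / x\<^sup>2 else 0"
  have bump: "bump = (\<lambda>y. flat 1 (1 + y) * flat 1 (1 - y))"
    by (simp add: hump_def fun_eq_iff add.commute)
  have "((\<lambda>y. flat 1 (1 + y)) has_real_derivative ?D (1 + y) * 1) (at y)"
    by (rule DERIV_chain2[OF flat_1_has_derivative]) (auto intro!: derivative_eq_intros)
  moreover have "((\<lambda>y. flat 1 (1 - y)) has_real_derivative ?D (1 - y) * - 1) (at y)"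
    by (rule DERIV_chain2[OF flat_1_has_derivative]) (auto intro!: derivative_eq_intros)
  ultimately have "(bump has_real_derivative
      ?D (1 + y) * 1 * flat 1 (1 - y) + ?D (1 - y) * - 1 * flat 1 (1 + y)) (at y)"
    unfolding bump by (rule DERIV_mult)
  then have "deriv bump y = ?D (1 + y) * flat 1 (1 - y) - ?D (1 - y) * flat 1 (1 + y)"
    by (simp only: DERIV_imp_deriv)
  also have "\<dots> = (if \<bar>y\<bar> < 1 then (1 / (1 + y)\<^sup>2 - 1 / (1 - y)\<^sup>2) * bump y else 0)"
    by (auto simp: hump_def flat_def abs_if algebra_simps split: if_splits)
  finally show ?thesis .
qed

lemma deriv_bump_nonneg:
  assumes "y \<le> 0"
  shows "deriv bump y \<ge> 0"
proof (cases "\<bar>y\<bar> < 1")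
  case True
  have "(1 + y)\<^sup>2 \<le> (1 - y)\<^sup>2"
    using True assms by (intro power_mono) auto
  then have "1 / (1 - y)\<^sup>2 \<le> 1 / (1 + y)\<^sup>2"
    using True by (intro divide_left_mono) auto
  then show ?thesis
    by (simp add: deriv_bump hump_bounds(1))
qed (simp add: deriv_bump)

lemma deriv_bump_nonpos:
  assumes "y \<ge> 0"
  shows "deriv bump y \<le> 0"
proof (cases "\<bar>y\<bar> < 1")
  case True
  have "(1 - y)\<^sup>2 \<le> (1 + y)\<^sup>2"
    using True assms by (intro power_mono) auto
  then have "1 / (1 + y)\<^sup>2 \<le> 1 / (1 - y)\<^sup>2"
    using True by (intro divide_left_mono) auto
  then show ?thesis
    by (simp add: deriv_bump hump_bounds(1) mult_nonpos_nonneg)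
qed (simp add: deriv_bump)

lemma deriv_bump_bounded:
  obtains M where "M > 0" "\<And>y. \<bar>deriv bump y\<bar> \<le> M"
proof -
  have "compact (deriv bump ` {-1..1})"
    by (intro compact_continuous_image continuous_on_subset[OF C_infinity_on_UNIV_D(3)[OF bump_smooth]]) auto
  then obtain M where M: "M > 0" "\<And>z. z \<in> deriv bump ` {-1..1} \<Longrightarrow> norm z \<le> M"
    using bounded_pos[of "deriv bump ` {-1..1}"] compact_imp_bounded by blast
  show thesis
  proof (rule that[OF M(1)])
    fix y
    show "\<bar>deriv bump y\<bar> \<le> M"
    proof (cases "\<bar>y\<bar> < 1")
      case True
      then have "y \<in> {-1..1}" by auto
      then show ?thesis using M(2)[of "deriv bump y"] by simp
    next
      case False
      then have "deriv bump y = 0" by (simp add: deriv_bump)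
      then show ?thesis using M(1) by simp
    qed
  qed
qed

lemma bump_scaled_has_derivative:
  "((\<lambda>x. c * bump (k * x)) has_real_derivative c * (k * deriv bump (k * x))) (at x)"
proof (rule DERIV_cmult)
  show "((\<lambda>x. bump (k * x)) has_real_derivative k * deriv bump (k * x)) (at x)"
    using DERIV_chain2[OF C_infinity_on_UNIV_D(1)[OF bump_smooth] DERIV_cmult_Id[of k x UNIV]]
    by (simp add: mult.commute)
qed

text \<open>The rescaled bump is itself a hump with slope parameter \<open>k\<close> and endpoints
  \<open>- 1 / k\<close> and \<open>1 / k\<close>.\<close>

lemma bump_scaled_test_function:
  assumes "k > 0" "{- (1 / k)..1 / k} \<subseteq> S"
  shows "(\<lambda>x. c * bump (k * x)) \<in> test_functions S"
proof -
  have "bump (k * x) = hump k (- (1 / k)) (1 / k) x" for x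
    using assms(1) by (simp add: hump_def distrib_left right_diff_distrib)
  then show ?thesis
    using hump_test_function[OF assms, of c] by simp
qed

section \<open>Weak derivatives on an interval\<close>

text \<open>The positive and negative parts of \<open>f\<close> are densities of finite measures
  that agree on all rays, and rays determine such measures. Hence the two parts agree almost
  everywhere; as one of them is zero at each point, both are.\<close>

lemma AE_eq_0_if_ray_integrals_0:
  fixes f :: "real \<Rightarrow> real"
  assumes f: "integrable lborel f"
    and zero: "\<And>x. (LINT y|lborel. indicator {x<..} y * f y) = 0"
  shows "AE y in lborel. f y = 0"
proof -
  have [measurable]: "f \<in> borel_measurable borel"
    using f by auto
  have fin: "(\<integral>\<^sup>+y. ennreal (f y) \<partial>lborel) < \<infinity>" "(\<integral>\<^sup>+y. ennreal (- f y) \<partial>lborel) < \<infinity>"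
    using f by (auto simp: real_integrable_def less_top)
  have ray: "emeasure (density lborel h) {x<..} = (\<integral>\<^sup>+y. h y * indicator {x<..} y \<partial>lborel)"
    if "h \<in> borel_measurable borel" for h :: "real \<Rightarrow> ennreal" and x
    using that by (simp add: emeasure_density)
  have eq: "(\<integral>\<^sup>+y. ennreal (f y) * indicator {x<..} y \<partial>lborel)
      = (\<integral>\<^sup>+y. ennreal (- f y) * indicator {x<..} y \<partial>lborel)"
    and fin_ray: "(\<integral>\<^sup>+y. ennreal (f y) * indicator {x<..} y \<partial>lborel) < \<infinity>" for x
  proof -
    let ?p = "\<integral>\<^sup>+y. ennreal (f y) * indicator {x<..} y \<partial>lborel"
    let ?q = "\<integral>\<^sup>+y. ennreal (- f y) * indicator {x<..} y \<partial>lborel"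
    have "integrable lborel (\<lambda>y. indicator {x<..} y * f y)"
      using integrable_mult_indicator[OF _ f, of "{x<..}"] by simp
    then have "(LINT y|lborel. indicator {x<..} y * f y) =
        enn2real (\<integral>\<^sup>+y. ennreal (indicator {x<..} y * f y) \<partial>lborel) -
        enn2real (\<integral>\<^sup>+y. ennreal (- (indicator {x<..} y * f y)) \<partial>lborel)"
      by (rule real_lebesgue_integral_def)
    also have "(\<integral>\<^sup>+y. ennreal (indicator {x<..} y * f y) \<partial>lborel) = ?p"
      by (intro nn_integral_cong) (auto split: split_indicator)
    also have "(\<integral>\<^sup>+y. ennreal (- (indicator {x<..} y * f y)) \<partial>lborel) = ?q"
      by (intro nn_integral_cong) (auto split: split_indicator)
    finally have e: "enn2real ?p = enn2real ?q"
      using zero[of x] by simp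
    have "?p \<le> (\<integral>\<^sup>+y. ennreal (f y) \<partial>lborel)" "?q \<le> (\<integral>\<^sup>+y. ennreal (- f y) \<partial>lborel)"
      by (auto intro!: nn_integral_mono split: split_indicator)
    \<comment> \<open>Finiteness lets the equality of the \<open>enn2real\<close> values be lifted
      to the extended reals.\<close>
    then have "?p < \<infinity>" "?q < \<infinity>"
      using fin by (auto intro: le_less_trans)
    moreover from this have "?p = ennreal (enn2real ?p)" "?q = ennreal (enn2real ?q)"
      by simp_all
    ultimately show "?p = ?q" "?p < \<infinity>"
      using e by simp_all
  qed
  have "density lborel (\<lambda>y. ennreal (f y)) = density lborel (\<lambda>y. ennreal (- f y))"
  proof (rule measure_eqI_lessThan)
    fix x
    show "emeasure (density lborel (\<lambda>y. ennreal (f y))) {x<..} < \<infinity>"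
      using fin_ray[of x] by (simp add: ray)
    show "emeasure (density lborel (\<lambda>y. ennreal (f y))) {x<..}
        = emeasure (density lborel (\<lambda>y. ennreal (- f y))) {x<..}"
      using eq[of x] by (simp add: ray)
  qed simp_all
  then have "AE y in lborel. ennreal (f y) = ennreal (- f y)"
    using fin by (subst (asm) finite_density_unique) auto
  then show ?thesis
  proof eventually_elim
    case (elim y)
    then show ?case
      by (cases "0 \<le> f y") (auto simp: ennreal_neg)
  qed
qed

text \<open>Reduces to the Borel case by replacing \<open>f\<close> with a Borel function that
  agrees with it almost everywhere.\<close>

lemma lebesgue_AE_eq_0_if_ray_integrals_0:
  fixes f :: "real \<Rightarrow> real"
  assumes f: "integrable lebesgue f"
    and zero: "\<And>x. (LINT y|lebesgue. indicator {x<..} y * f y) = 0"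
  shows "AE y in lebesgue. f y = 0"
proof -
  obtain h where h[measurable]: "h \<in> borel_measurable lborel" and ae: "AE y in lborel. f y = h y"
    using completion_ex_borel_measurable_real[of f lborel] f by auto
  have ae': "AE y in lebesgue. f y = h y"
    by (rule AE_completion[OF ae])
  have [measurable]: "f \<in> borel_measurable lebesgue"
    using f by auto
  have h': "h \<in> borel_measurable lebesgue"
    using h by (simp add: measurable_completion)
  have "integrable lebesgue h"
    by (rule integrable_cong_AE_imp[OF f]) (use h' ae' in auto)
  then have "integrable lborel h"
    by (subst (asm) integrable_completion) auto
  moreover have "(LINT y|lborel. indicator {x<..} y * h y) = 0" for x
  proof -
    have "(LINT y|lborel. indicator {x<..} y * h y) = (LINT y|lebesgue. indicator {x<..} y * h y)"
      by (rule integral_completion[symmetric]) measurable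
    also have "\<dots> = (LINT y|lebesgue. indicator {x<..} y * f y)"
    proof (rule integral_cong_AE)
      show "(\<lambda>y. indicator {x<..} y * h y) \<in> borel_measurable lebesgue"
        by (rule measurable_completion) measurable
      show "(\<lambda>y. indicator {x<..} y * f y) \<in> borel_measurable lebesgue"
        by (intro borel_measurable_times measurable_completion[of "indicator {x<..}"]) auto
      show "AE y in lebesgue. indicator {x<..} y * h y = indicator {x<..} y * f y"
        using ae' by eventually_elim simp
    qed
    finally show ?thesis using zero by simp
  qed
  ultimately have "AE y in lborel. h y = 0"
    by (rule AE_eq_0_if_ray_integrals_0)
  then have "AE y in lebesgue. h y = 0"
    by (rule AE_completion)
  with ae' show ?thesis
    by eventually_elim simp
qed

text \<open>A ray cuts a subinterval in a subinterval or in the empty set, so the ray criterion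
  applies after restriction. Countably many subintervals, at distance \<open>1 / (n + 1)\<close>
  from the endpoints, then exhaust the interval; this way only local integrability is used.\<close>

lemma AE_eq_0_if_subinterval_integrals_0:
  fixes f :: "real \<Rightarrow> real"
  assumes int: "\<And>c d. a < c \<Longrightarrow> c < d \<Longrightarrow> d < b \<Longrightarrow> integrable lebesgue (\<lambda>x. indicator {c<..<d} x * f x)"
    and zero: "\<And>c d. a < c \<Longrightarrow> c < d \<Longrightarrow> d < b \<Longrightarrow> (LINT x|lebesgue. indicator {c<..<d} x * f x) = 0"
  shows "AE x in lebesgue_on {a<..<b}. f x = 0"
proof -
  have "AE x in lebesgue. x \<in> {c<..<d} \<longrightarrow> f x = 0" if cd: "a < c" "d < b" for c d
  proof (cases "c < d")
    case True
    have "AE x in lebesgue. indicator {c<..<d} x * f x = 0"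
    proof (rule lebesgue_AE_eq_0_if_ray_integrals_0)
      show "integrable lebesgue (\<lambda>x. indicator {c<..<d} x * f x)"
        using int cd True by blast
      fix x
      have "(\<lambda>y. indicator {x<..} y * (indicator {c<..<d} y * f y))
          = (\<lambda>y. indicator {max x c<..<d} y * f y)"
        by (auto split: split_indicator)
      moreover have "(LINT y|lebesgue. indicator {max x c<..<d} y * f y) = 0"
        using zero[of "max x c" d] cd by (cases "max x c < d") auto
      ultimately show "(LINT y|lebesgue. indicator {x<..} y * (indicator {c<..<d} y * f y)) = 0"
        by simp
    qed
    then show ?thesis
      by eventually_elim (auto split: split_indicator)
  qed auto
  then have "AE x in lebesgue. \<forall>n. x \<in> {a + inverse (real (Suc n))<..<b - inverse (real (Suc n))} \<longrightarrow> f x = 0"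
    by (subst AE_all_countable) auto
  then have "AE x in lebesgue. x \<in> {a<..<b} \<longrightarrow> f x = 0"
  proof eventually_elim
    case (elim x)
    show ?case
    proof
      assume "x \<in> {a<..<b}"
      then obtain n where "inverse (real (Suc n)) < min (x - a) (b - x)"
        using reals_Archimedean[of "min (x - a) (b - x)"] by auto
      then show "f x = 0"
        using elim[rule_format, of n] by simp
    qed
  qed
  then show ?thesis
    by (subst AE_restrict_space_iff) auto
qed

section \<open>Classical derivatives as weak derivatives, and uniqueness of weak derivatives\<close>

lemma integrable_lebesgue_on_continuous:
  fixes f :: "real \<Rightarrow> real"
  assumes "continuous_on {a..b} f" "S \<subseteq> {a..b}" "S \<in> sets lebesgue"
  shows "integrable (lebesgue_on S) f"
proof -
  have "set_integrable lebesgue {a..b} f"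
    using continuous_imp_integrable_real[OF assms(1)]
    by (simp add: set_integrable_def integrable_restrict_space)
  then have "set_integrable lebesgue S f"
    by (rule set_integrable_subset) (use assms in auto)
  then show ?thesis
    using assms(3) by (simp add: set_integrable_def integrable_restrict_space)
qed

lemma continuous_L1_loc:
  fixes f :: "real \<Rightarrow> real"
  assumes "continuous_on UNIV f" "S \<in> sets lebesgue"
  shows "f \<in> L1_loc S"
proof -
  have "f \<in> borel_measurable lebesgue"
    using assms(1) by (intro measurable_completion) (auto intro: borel_measurable_continuous_onI)
  then have "f \<in> borel_measurable (lebesgue_on S)"
    by (rule measurable_restrict_space1)
  moreover have "integrable (lebesgue_on K) f" if K: "compact K" for K
  proof -
    obtain c where c: "K \<subseteq> {-c..c}"
      using bounded_subset_cbox_symmetric[OF compact_imp_bounded[OF K]] by (metis box_real(2))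
    show ?thesis
      by (rule integrable_lebesgue_on_continuous[OF _ c])
        (use K assms(1) in \<open>auto intro: continuous_on_subset fmeasurableD lmeasurable_compact\<close>)
  qed
  ultimately show ?thesis
    by (simp add: L1_loc_def)
qed

lemma test_function_D:
  assumes "\<eta> \<in> test_functions S"
  shows "C_infinity_on UNIV \<eta>" "x \<notin> S \<Longrightarrow> \<eta> x = 0"
proof -
  have sub: "{x. \<eta> x \<noteq> 0} \<subseteq> S"
  proof (rule subset_trans[OF closure_subset])
    show "closure {x. \<eta> x \<noteq> 0} \<subseteq> S"
      using assms by (simp add: test_functions_def)
  qed
  show "\<eta> x = 0" if "x \<notin> S"
    using subsetD[OF sub, of x] that by auto
qed (use assms in \<open>simp add: test_functions_def\<close>)

text \<open>Integration by parts: the boundary terms vanish because \<open>a\<close> and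
  \<open>b\<close> lie outside the open interval that contains the support of the test
  function.\<close>

lemma C_infinity_has_weak_deriv:
  assumes u: "C_infinity_on UNIV u"
  shows "has_weak_deriv {a<..<b} u (deriv u)"
  unfolding has_weak_deriv_def
proof (intro conjI ballI)
  show "u \<in> L1_loc {a<..<b}" "deriv u \<in> L1_loc {a<..<b}"
    by (intro continuous_L1_loc C_infinity_on_UNIV_D[OF u]; simp)+
  fix \<eta> assume "\<eta> \<in> test_functions {a<..<b}"
  note \<eta> = test_function_D[OF this]
  note Du = C_infinity_on_UNIV_D[OF u] and D\<eta> = C_infinity_on_UNIV_D[OF \<eta>(1)]
  note cont = continuous_on_subset[OF Du(2) subset_UNIV] continuous_on_subset[OF Du(3) subset_UNIV]
    continuous_on_subset[OF D\<eta>(2) subset_UNIV] continuous_on_subset[OF D\<eta>(3) subset_UNIV]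
  have int: "integrable (lebesgue_on {a<..<b}) (\<lambda>x. u x * deriv \<eta> x)"
    "integrable (lebesgue_on {a<..<b}) (\<lambda>x. deriv u x * \<eta> x)"
    by (rule integrable_lebesgue_on_continuous[of a b], intro continuous_on_mult cont, force, simp)+
  show "(LINT x|lebesgue_on {a<..<b}. u x * deriv \<eta> x) = - (LINT x|lebesgue_on {a<..<b}. deriv u x * \<eta> x)"
  proof (cases "a \<le> b")
    case True
    have "((\<lambda>x. u x * deriv \<eta> x + deriv u x * \<eta> x) has_integral u b * \<eta> b - u a * \<eta> a) {a..b}"
    proof (rule fundamental_theorem_of_calculus[OF True])
      fix x
      have "((\<lambda>x. u x * \<eta> x) has_real_derivative u x * deriv \<eta> x + deriv u x * \<eta> x) (at x within {a..b})"
        using has_field_derivative_at_within[OF DERIV_mult[OF Du(1) D\<eta>(1), of x]]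
        by (simp add: algebra_simps)
      then show "((\<lambda>x. u x * \<eta> x) has_vector_derivative u x * deriv \<eta> x + deriv u x * \<eta> x) (at x within {a..b})"
        by (simp add: has_real_derivative_iff_has_vector_derivative)
    qed
    then have "integral {a<..<b} (\<lambda>x. u x * deriv \<eta> x + deriv u x * \<eta> x) = 0"
      using \<eta>(2)[of a] \<eta>(2)[of b] by (simp add: has_integral_Icc_iff_Ioo integral_unique)
    then have "(LINT x|lebesgue_on {a<..<b}. u x * deriv \<eta> x + deriv u x * \<eta> x) = 0"
      using int by (subst lebesgue_integral_eq_integral) simp_all
    then show ?thesis
      using int by simp
  qed simp
qed

lemma L1_loc_integrable_indicator:
  assumes "v \<in> L1_loc {a<..<b}" "a < c" "d < b"
  shows "integrable (lebesgue_on {a<..<b}) (\<lambda>x. indicator {c..d} x * v x)"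
    "integrable lebesgue (\<lambda>x. indicator {c<..<d} x * v x)"
proof -
  have "integrable (lebesgue_on {c..d}) v"
  proof -
    have "{c..d} \<subseteq> {a<..<b}"
      using assms by auto
    then show ?thesis
      using assms(1) unfolding L1_loc_def by (simp add: compact_Icc)
  qed
  then have i: "integrable lebesgue (\<lambda>x. indicator {c..d} x * v x)"
    by (simp add: integrable_restrict_space)
  have "integrable lebesgue (\<lambda>x. indicator {a<..<b} x *\<^sub>R (indicator {c..d} x * v x))"
    "integrable lebesgue (\<lambda>x. indicator {c<..<d} x *\<^sub>R (indicator {c..d} x * v x))"
    using i by (auto intro!: integrable_mult_indicator simp del: real_scaleR_def)
  moreover have "(\<lambda>x. indicator {c<..<d} x *\<^sub>R (indicator {c..d} x * v x)) = (\<lambda>x. indicator {c<..<d} x * v x)"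
    by (auto split: split_indicator)
  ultimately show "integrable (lebesgue_on {a<..<b}) (\<lambda>x. indicator {c..d} x * v x)"
    "integrable lebesgue (\<lambda>x. indicator {c<..<d} x * v x)"
    by (simp_all add: integrable_restrict_space)
qed

text \<open>Dominated convergence, with the absolute value of \<open>v\<close> on the closed
  interval from \<open>c\<close> to \<open>d\<close> as majorant: humps take values between 0 and 1
  and vanish outside.\<close>

lemma L1_loc_mult_hump_tendsto:
  assumes v: "v \<in> L1_loc {a<..<b}" and cd: "a < c" "d < b"
  shows "(\<lambda>n. LINT x|lebesgue_on {a<..<b}. v x * hump (real (Suc n)) c d x)
    \<longlonglongrightarrow> (LINT x|lebesgue. indicator {c<..<d} x * v x)"
proof -
  have v_meas: "v \<in> borel_measurable (lebesgue_on {a<..<b})"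
    using v by (simp add: L1_loc_def)
  have hump: "hump n c d \<in> borel_measurable (lebesgue_on {a<..<b})" for n
    using continuous_L1_loc[OF C_infinity_on_UNIV_D(2)[OF C_infinity_hump], of "{a<..<b}" 1 n c d]
    by (simp add: L1_loc_def)
  have "(\<lambda>n. LINT x|lebesgue_on {a<..<b}. v x * hump (real (Suc n)) c d x)
    \<longlonglongrightarrow> (LINT x|lebesgue_on {a<..<b}. v x * indicator {c<..<d} x)"
  proof (rule integral_dominated_convergence)
    show "integrable (lebesgue_on {a<..<b}) (\<lambda>x. \<bar>indicator {c..d} x * v x\<bar>)"
      using L1_loc_integrable_indicator(1)[OF v cd] by (rule integrable_abs)
    show "AE x in lebesgue_on {a<..<b}. (\<lambda>n. v x * hump (real (Suc n)) c d x) \<longlonglongrightarrow> v x * indicator {c<..<d} x"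
      by (intro AE_I2 tendsto_mult tendsto_const hump_tendsto_indicator)
    fix n
    have "norm (v x * hump (real (Suc n)) c d x) \<le> \<bar>indicator {c..d} x * v x\<bar>" for x
    proof (cases "x \<in> {c..d}")
      case True
      then show ?thesis
        using hump_bounds[of "real (Suc n)" c d x] by (simp add: abs_mult mult_left_le del: of_nat_Suc)
    next
      case False
      then show ?thesis
        by (subst hump_eq_0) auto
    qed
    then show "AE x in lebesgue_on {a<..<b}. norm (v x * hump (real (Suc n)) c d x) \<le> \<bar>indicator {c..d} x * v x\<bar>"
      by simp
  next
    show "(\<lambda>x. v x * indicator {c<..<d} x) \<in> borel_measurable (lebesgue_on {a<..<b})"
      by (intro borel_measurable_times v_meas measurable_restrict_space1[OF measurable_completion]) auto
    show "(\<lambda>x. v x * hump (real (Suc n)) c d x) \<in> borel_measurable (lebesgue_on {a<..<b})" for n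
      by (intro borel_measurable_times v_meas hump)
  qed
  also have "(LINT x|lebesgue_on {a<..<b}. v x * indicator {c<..<d} x) = (LINT x|lebesgue. indicator {c<..<d} x * v x)"
    using cd by (subst integral_restrict_space) (auto intro!: Bochner_Integration.integral_cong split: split_indicator)
  finally show ?thesis .
qed

text \<open>Testing both functions with the same humps and passing to the limit gives equal
  integrals over every compactly contained subinterval.\<close>

lemma has_weak_deriv_unique:
  assumes v: "has_weak_deriv {a<..<b} u v" and w: "has_weak_deriv {a<..<b} u w"
  shows "AE x in lebesgue_on {a<..<b}. v x = w x"
proof -
  have L: "v \<in> L1_loc {a<..<b}" "w \<in> L1_loc {a<..<b}"
    using v w by (auto simp: has_weak_deriv_def)
  have "AE x in lebesgue_on {a<..<b}. v x - w x = 0"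
  proof (rule AE_eq_0_if_subinterval_integrals_0)
    fix c d assume cd: "a < c" "c < d" "d < b"
    note int = L1_loc_integrable_indicator(2)[OF L(1) cd(1,3)] L1_loc_integrable_indicator(2)[OF L(2) cd(1,3)]
    show "integrable lebesgue (\<lambda>x. indicator {c<..<d} x * (v x - w x))"
      using int by (simp add: right_diff_distrib)
    have tf: "hump (real (Suc n)) c d \<in> test_functions {a<..<b}" for n
      using hump_test_function[of "real (Suc n)" c d "{a<..<b}" 1] cd by (auto simp: subset_iff)
    have "(LINT x|lebesgue_on {a<..<b}. v x * hump (real (Suc n)) c d x)
        = (LINT x|lebesgue_on {a<..<b}. w x * hump (real (Suc n)) c d x)" for n
      using bspec[OF conjunct2[OF conjunct2[OF v[unfolded has_weak_deriv_def]]] tf[of n]]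
        bspec[OF conjunct2[OF conjunct2[OF w[unfolded has_weak_deriv_def]]] tf[of n]] by linarith
    then have "(LINT x|lebesgue. indicator {c<..<d} x * v x) = (LINT x|lebesgue. indicator {c<..<d} x * w x)"
      using L1_loc_mult_hump_tendsto[OF L(1) cd(1,3)] L1_loc_mult_hump_tendsto[OF L(2) cd(1,3)]
      by (simp add: LIMSEQ_unique)
    then show "(LINT x|lebesgue. indicator {c<..<d} x * (v x - w x)) = 0"
      using int by (simp add: right_diff_distrib)
  qed
  then show ?thesis
    by simp
qed

text \<open>\<open>weak_deriv\<close> is an arbitrary choice. The classical derivative witnesses
  that some choice exists, and uniqueness identifies the chosen one up to a null set.\<close>

lemma weak_deriv_C_infinity:
  assumes "C_infinity_on UNIV u"
  shows "AE x in lebesgue_on {a<..<b}. weak_deriv {a<..<b} u x = deriv u x"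
proof -
  have "has_weak_deriv {a<..<b} u (weak_deriv {a<..<b} u)"
    unfolding weak_deriv_def
    by (rule someI_ex[of "has_weak_deriv {a<..<b} u"]) (use C_infinity_has_weak_deriv[OF assms] in blast)
  then show ?thesis
    using C_infinity_has_weak_deriv[OF assms] by (rule has_weak_deriv_unique)
qed

section \<open>Membership in the function spaces\<close>

lemma continuous_L2:
  assumes "continuous_on UNIV f"
  shows "f \<in> L2 {a<..<b}"
proof -
  have "integrable (lebesgue_on {a<..<b}) (\<lambda>x. (f x)\<^sup>2)"
    using assms by (intro integrable_lebesgue_on_continuous[of a b] continuous_intros) (auto intro: continuous_on_subset)
  moreover have "f \<in> borel_measurable (lebesgue_on {a<..<b})"
    using continuous_L1_loc[OF assms, of "{a<..<b}"] by (simp add: L1_loc_def)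
  ultimately show ?thesis
    by (simp add: L2_def)
qed

text \<open>The constant sequence approximates: its distance is zero because the chosen weak
  derivative agrees with the classical one almost everywhere.\<close>

lemma test_function_H1_0:
  assumes "\<eta> \<in> test_functions {a<..<b}"
  shows "\<eta> \<in> H1_0 {a<..<b}"
proof -
  note smooth = test_function_D(1)[OF assms]
  have "\<eta> \<in> H1 {a<..<b}"
    unfolding H1_def
    using C_infinity_on_UNIV_D(2,3)[OF smooth] C_infinity_has_weak_deriv[OF smooth] continuous_L2 by blast
  moreover have "(LINT x|lebesgue_on {a<..<b}. (\<eta> x - \<eta> x)\<^sup>2 + (deriv \<eta> x - weak_deriv {a<..<b} \<eta> x)\<^sup>2) = 0"
    by (rule integral_eq_zero_AE) (use weak_deriv_C_infinity[OF smooth, of a b] in \<open>eventually_elim, simp\<close>)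
  ultimately show ?thesis
    unfolding H1_0_def using assms by (auto intro!: exI[of _ "\<lambda>_. \<eta>"])
qed

text \<open>Completeness of Lebesgue measure transfers measurability from \<open>g\<close> to
  \<open>f\<close>. This is meant for energy densities, where only the simplified side is shown to
  be measurable.\<close>

lemma integral_lebesgue_on_cong_AE:
  fixes f g :: "real \<Rightarrow> real"
  assumes S: "S \<in> sets lebesgue" and g: "g \<in> borel_measurable (lebesgue_on S)"
    and ae: "AE x in lebesgue_on S. f x = g x"
  shows "integral\<^sup>L (lebesgue_on S) f = integral\<^sup>L (lebesgue_on S) g"
proof (rule integral_cong_AE[OF _ g ae])
  have "AE x in lebesgue. (if x \<in> S then g x else 0) = (if x \<in> S then f x else 0)"
    using ae S by (subst (asm) AE_restrict_space_iff) (auto elim!: eventually_mono)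
  then have "(\<lambda>x. if x \<in> S then f x else 0) \<in> borel_measurable lebesgue"
    by (rule borel_measurable_AE[OF borel_measurable_if_I[OF g S]])
  then show "f \<in> borel_measurable (lebesgue_on S)"
    by (rule borel_measurable_if_D)
qed

lemma integrable_lebesgue_on_bounded:
  fixes f :: "real \<Rightarrow> real"
  assumes "f \<in> borel_measurable (lebesgue_on {a<..<b})" "\<And>x. x \<in> {a<..<b} \<Longrightarrow> \<bar>f x\<bar> \<le> B"
  shows "integrable (lebesgue_on {a<..<b}) f"
proof -
  interpret finite_measure "lebesgue_on {a<..<b}"
    by (rule finite_measure_lebesgue_on) simp
  show ?thesis
  proof (rule integrable_const_bound[OF _ assms(1)])
    show "AE x in lebesgue_on {a<..<b}. norm (f x) \<le> B"
      using assms(2) by (intro AE_I2) simp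
  qed
qed

section \<open>Measurability of monotone and of rescaled functions\<close>

lemma antimono_on_times_indicator_measurable:
  fixes f :: "real \<Rightarrow> real"
  assumes "antimono_on A f" "A \<in> sets borel"
  shows "(\<lambda>x. f x * indicator A x) \<in> borel_measurable borel"
proof -
  have "mono_on A (\<lambda>x. - f x)"
    using assms(1) by (auto simp: monotone_on_def)
  then have "(\<lambda>x. - f x) \<in> borel_measurable (restrict_space borel A)"
    by (rule borel_measurable_mono_on_fnc)
  then have "(\<lambda>x. - f x * indicator A x) \<in> borel_measurable borel"
    using assms(2) by (subst (asm) borel_measurable_restrict_space_iff) (simp_all add: mult.commute)
  then have "(\<lambda>x. - (- f x * indicator A x)) \<in> borel_measurable borel"
    by (rule borel_measurable_uminus)
  then show ?thesis by simp
qed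

lemma continuous_comp_scale_measurable:
  assumes "continuous_on UNIV f"
  shows "(\<lambda>x::real. f (k * x) :: real) \<in> borel_measurable (lebesgue_on S)"
proof -
  have "continuous_on UNIV (\<lambda>x. f (k * x))"
    by (intro continuous_on_compose2[OF assms]) (auto intro: continuous_intros)
  then have "(\<lambda>x. f (k * x)) \<in> borel_measurable lebesgue"
    by (intro measurable_completion) (simp add: borel_measurable_continuous_onI)
  then show ?thesis
    by (rule measurable_restrict_space1)
qed

lemmas bump_continuous = C_infinity_on_UNIV_D(2)[OF bump_smooth]
  and deriv_bump_continuous = C_infinity_on_UNIV_D(3)[OF bump_smooth]

section \<open>The steady state\<close>

lemma pressure_law_D:
  assumes P: "pressure_law P"
  shows "z > 0 \<Longrightarrow> (P has_real_derivative deriv P z) (at z)"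
    and "z > 0 \<Longrightarrow> deriv P z \<ge> 0"
    and "continuous_on {0<..} (deriv P)"
    and "strict_mono_on {0<..} P"
proof -
  show mono: "strict_mono_on {0<..} P"
    using P by (simp add: pressure_law_def)
  have smooth: "C_infinity_on {0<..} P"
    using P by (simp add: pressure_law_def)
  have d: "P differentiable_on {0<..}" "deriv P differentiable_on {0<..}"
    using smooth[unfolded C_infinity_on_def, rule_format, of 0]
      smooth[unfolded C_infinity_on_def, rule_format, of 1] by simp_all
  show "continuous_on {0<..} (deriv P)"
    using d(2) by (rule differentiable_imp_continuous_on)
  show D: "(P has_real_derivative deriv P z) (at z)" if "z > 0"
  proof -
    have "P differentiable (at z within {0<..})"
      using d(1) that by (simp add: differentiable_on_def)
    then have "P differentiable (at z)"
      using that at_within_open[of z "{0<..}"] by simp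
    then show ?thesis
      by (simp add: DERIV_deriv_iff_real_differentiable)
  qed
  show "deriv P z \<ge> 0" if "z > 0"
  proof (rule mono_on_imp_deriv_nonneg[OF _ D[OF that]])
    show "mono_on {0<..} P"
      using mono by (rule strict_mono_on_imp_mono_on)
    show "z \<in> interior {0<..}"
      using that by (simp add: interior_open)
  qed
qed

lemma enthalpy_has_derivative:
  assumes P: "pressure_law P" and z: "z > 0"
  shows "(enthalpy P has_real_derivative deriv P z / z) (at z)"
proof -
  \<comment> \<open>The compact interval has to contain the base point 1, have \<open>z\<close> in
    its interior and stay away from the singularity of \<open>1 / r\<close> at 0.\<close>
  define a b where "a = min 1 z / 2" and "b = max 1 z + 1"
  have ab: "0 < a" "a < z" "z < b" "a \<le> 1" "1 \<le> b"
    using z by (auto simp: a_def b_def)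
  have "continuous_on {a..b} (\<lambda>r. deriv P r / r)"
    by (intro continuous_intros continuous_on_subset[OF pressure_law_D(3)[OF P]]) (use ab in auto)
  then have "((\<lambda>u. LBINT y=ereal 1..ereal u. deriv P y / y) has_vector_derivative deriv P z / z) (at z within {a..b})"
    using ab by (intro interval_integral_FTC2) auto
  moreover have "(at z within {a..b}) = at z"
    using ab by (intro at_within_interior) simp
  ultimately show ?thesis
    unfolding enthalpy_def[abs_def] has_real_derivative_iff_has_vector_derivative
    by (simp add: one_ereal_def)
qed

lemma enthalpy_continuous_on: "pressure_law P \<Longrightarrow> continuous_on {0<..} (enthalpy P)"
  by (intro continuous_at_imp_continuous_on ballI DERIV_isCont[OF enthalpy_has_derivative]) simp_all

text \<open>On \<open>(0, b]\<close> the integrand \<open>P' r / r\<close> dominates \<open>P' r / b\<close>, so the enthalpy inherits strict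
  monotonicity from \<open>P\<close> although \<open>P'\<close> may vanish.\<close>

lemma enthalpy_strict_mono_on:
  assumes P: "pressure_law P"
  shows "strict_mono_on {0<..} (enthalpy P)"
proof (rule strict_mono_onI)
  fix a b :: real
  assume ab: "a \<in> {0<..}" "b \<in> {0<..}" "a < b"
  have "enthalpy P a - P a / b \<le> enthalpy P b - P b / b"
  proof (rule DERIV_nonneg_imp_nondecreasing[of a b])
    fix x assume x: "a \<le> x" "x \<le> b"
    then have "x > 0" using ab by simp
    have "((\<lambda>z. enthalpy P z - P z / b) has_real_derivative deriv P x / x - deriv P x / b) (at x)"
      by (intro DERIV_diff DERIV_cdivide enthalpy_has_derivative pressure_law_D P \<open>x > 0\<close>)
    moreover have "0 \<le> deriv P x / x - deriv P x / b"
      using divide_left_mono[of x b "deriv P x"] x \<open>x > 0\<close> pressure_law_D(2)[OF P \<open>x > 0\<close>] by simp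
    ultimately show "\<exists>y. ((\<lambda>z. enthalpy P z - P z / b) has_real_derivative y) (at x) \<and> 0 \<le> y"
      by blast
  qed (use ab in simp)
  moreover have "P a / b < P b / b"
    using strict_mono_onD[OF pressure_law_D(4)[OF P] ab] ab by (simp add: divide_strict_right_mono)
  ultimately show "enthalpy P a < enthalpy P b"
    by simp
qed

lemma enthalpy_less_iff:
  "\<lbrakk>pressure_law P; 0 < u; 0 < v\<rbrakk> \<Longrightarrow> enthalpy P u < enthalpy P v \<longleftrightarrow> u < v"
  using strict_mono_onD[OF enthalpy_strict_mono_on, of P u v] strict_mono_onD[OF enthalpy_strict_mono_on, of P v u]
  by (cases u v rule: linorder_cases) auto

lemma enthalpy_le_iff:
  "\<lbrakk>pressure_law P; 0 < u; 0 < v\<rbrakk> \<Longrightarrow> enthalpy P u \<le> enthalpy P v \<longleftrightarrow> u \<le> v"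
  using enthalpy_less_iff[of P v u] by (simp add: linorder_not_less[symmetric])

text \<open>The intermediate value theorem provides a preimage, so \<open>inv_into\<close> returns a
  genuine one; strict monotonicity then locates it between \<open>a\<close> and
  \<open>b\<close>.\<close>

lemma inv_into_in_Icc:
  fixes h :: "real \<Rightarrow> real"
  assumes mono: "strict_mono_on {0<..} h" and cont: "continuous_on {0<..} h"
    and ab: "0 < a" "0 < b" "h a \<le> y" "y \<le> h b"
  shows "inv_into {0<..} h y \<in> {a..b}" "h (inv_into {0<..} h y) = y"
proof -
  have le: "u \<le> v" if "h u \<le> h v" "0 < u" "0 < v" for u v
    using that strict_mono_onD[OF mono, of v u] by force
  have "a \<le> b"
    using ab le[of a b] by simp
  moreover have "continuous_on {a..b} h"
    by (rule continuous_on_subset[OF cont]) (use ab in auto)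
  ultimately obtain z where z: "a \<le> z" "z \<le> b" "h z = y"
    using IVT'[of h a y b] ab by auto
  then have y: "y \<in> h ` {0<..}"
    using ab by auto
  let ?i = "inv_into {0<..} h y"
  have i_pos: "?i > 0" and i: "h ?i = y"
    using inv_into_into[OF y] f_inv_into_f[OF y] by simp_all
  then show "?i \<in> {a..b}"
    using le[of a ?i] le[of ?i b] ab i i_pos by simp
  show "h ?i = y" by (rule i)
qed

section \<open>The density profile on both sides of the interface\<close>

locale steady_state =
  fixes Pm Pp :: "real \<Rightarrow> real" and g m l rm :: real
  assumes g_pos: "g > 0" and m_pos: "m > 0" and l_pos: "l > 0"
    and Pm: "pressure_law Pm" and Pp: "pressure_law Pp"
    and rm_pos: "rm > 0" and P_gt: "Pm rm > Pp rm" and P_in: "Pm rm \<in> Pp ` {0<..}"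
    and hm_in: "enthalpy Pm rm + g * m \<in> enthalpy Pm ` {0<..}"
    and hp_in: "enthalpy Pp (rho_plus Pm Pp rm) - g * l \<in> enthalpy Pp ` {0<..}"
begin

abbreviation rp :: real where "rp \<equiv> rho_plus Pm Pp rm"
abbreviation \<rho> :: "real \<Rightarrow> real" where "\<rho> \<equiv> rho0 Pm Pp g rm"
abbreviation S :: "real set" where "S \<equiv> {-m<..<l}"

text \<open>Pressure is continuous across the interface, so \<open>Pp rp = Pm rm > Pp rm\<close>,
  and monotonicity of \<open>Pp\<close> puts the denser fluid on top. This is the source of the
  instability.\<close>

lemma rp_gt: "rp > rm" and rp_pos: "rp > 0"
proof -
  show "rp > 0"
    using inv_into_into[OF P_in] by (simp add: rho_plus_def)
  moreover have "Pp rp = Pm rm"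
    using f_inv_into_f[OF P_in] by (simp add: rho_plus_def)
  ultimately show "rp > rm"
    using strict_mono_onD[OF pressure_law_D(4)[OF Pp], of rp rm] P_gt rm_pos
    by (cases rp rm rule: linorder_cases) auto
qed

text \<open>The range hypotheses at the walls provide the densities \<open>z\<close> and
  \<open>z'\<close>. The prescribed enthalpy is affine in \<open>x\<close>, hence lies between its
  interface and wall values, and can be inverted there. The point 0 belongs to the upper branch, as
  in \<open>rho0\<close>.\<close>

lemma rho0_bounds:
  obtains z z' where "z > 0" "z' > 0"
    "\<And>x. -m < x \<Longrightarrow> x < 0 \<Longrightarrow> \<rho> x \<in> {rm..z} \<and> enthalpy Pm (\<rho> x) = enthalpy Pm rm - g * x"
    "\<And>x. 0 \<le> x \<Longrightarrow> x < l \<Longrightarrow> \<rho> x \<in> {z'..rp} \<and> enthalpy Pp (\<rho> x) = enthalpy Pp rp - g * x"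
proof -
  obtain z where z: "z > 0" "enthalpy Pm rm + g * m = enthalpy Pm z"
    using hm_in by auto
  obtain z' where z': "z' > 0" "enthalpy Pp rp - g * l = enthalpy Pp z'"
    using hp_in by auto
  show thesis
  proof (rule that[OF z(1) z'(1)])
    fix x assume x: "-m < x" "x < 0"
    have y: "enthalpy Pm rm \<le> enthalpy Pm rm - g * x" "enthalpy Pm rm - g * x \<le> enthalpy Pm z"
    proof -
      have "g * (- m) \<le> g * x" "g * x \<le> g * 0"
        using x g_pos by (intro mult_left_mono; simp)+
      then show "enthalpy Pm rm \<le> enthalpy Pm rm - g * x" "enthalpy Pm rm - g * x \<le> enthalpy Pm z"
        using z(2) by simp_all
    qed
    show "\<rho> x \<in> {rm..z} \<and> enthalpy Pm (\<rho> x) = enthalpy Pm rm - g * x"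
      using inv_into_in_Icc[OF enthalpy_strict_mono_on[OF Pm] enthalpy_continuous_on[OF Pm] rm_pos z(1) y] x
      by (simp add: rho0_def)
  next
    fix x assume x: "0 \<le> x" "x < l"
    have y: "enthalpy Pp z' \<le> enthalpy Pp rp - g * x" "enthalpy Pp rp - g * x \<le> enthalpy Pp rp"
    proof -
      have "g * x \<le> g * l" "g * 0 \<le> g * x"
        using x g_pos by (intro mult_left_mono; simp)+
      then show "enthalpy Pp z' \<le> enthalpy Pp rp - g * x" "enthalpy Pp rp - g * x \<le> enthalpy Pp rp"
        using z'(2) by simp_all
    qed
    show "\<rho> x \<in> {z'..rp} \<and> enthalpy Pp (\<rho> x) = enthalpy Pp rp - g * x"
      using inv_into_in_Icc[OF enthalpy_strict_mono_on[OF Pp] enthalpy_continuous_on[OF Pp] z'(1) rp_pos y] x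
      by (simp add: rho0_def)
  qed
qed

lemma rho0_pos: "x \<in> S \<Longrightarrow> \<rho> x > 0"
proof -
  obtain z z' where "z > 0" "z' > 0"
    "\<And>x. -m < x \<Longrightarrow> x < 0 \<Longrightarrow> \<rho> x \<in> {rm..z} \<and> enthalpy Pm (\<rho> x) = enthalpy Pm rm - g * x"
    "\<And>x. 0 \<le> x \<Longrightarrow> x < l \<Longrightarrow> \<rho> x \<in> {z'..rp} \<and> enthalpy Pp (\<rho> x) = enthalpy Pp rp - g * x"
    by (rule rho0_bounds) blast
  note z = this(1,2) this(3)[of x] this(4)[of x]
  assume "x \<in> S"
  then show ?thesis
    using z rm_pos by (cases "x < 0") auto
qed

lemma enthalpy_rho0:
  "-m < x \<Longrightarrow> x < 0 \<Longrightarrow> enthalpy Pm (\<rho> x) = enthalpy Pm rm - g * x"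
  "0 \<le> x \<Longrightarrow> x < l \<Longrightarrow> enthalpy Pp (\<rho> x) = enthalpy Pp rp - g * x"
proof -
  obtain z z' where "z > 0" "z' > 0"
    "\<And>x. -m < x \<Longrightarrow> x < 0 \<Longrightarrow> \<rho> x \<in> {rm..z} \<and> enthalpy Pm (\<rho> x) = enthalpy Pm rm - g * x"
    "\<And>x. 0 \<le> x \<Longrightarrow> x < l \<Longrightarrow> \<rho> x \<in> {z'..rp} \<and> enthalpy Pp (\<rho> x) = enthalpy Pp rp - g * x"
    by (rule rho0_bounds) blast
  then show "-m < x \<Longrightarrow> x < 0 \<Longrightarrow> enthalpy Pm (\<rho> x) = enthalpy Pm rm - g * x"
    "0 \<le> x \<Longrightarrow> x < l \<Longrightarrow> enthalpy Pp (\<rho> x) = enthalpy Pp rp - g * x"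
    by simp_all
qed

lemma rho0_bounded:
  obtains R where "R > 0" "\<And>x. x \<in> S \<Longrightarrow> \<rho> x \<le> R"
proof -
  obtain z z' where z: "z > 0" "z' > 0"
    "\<And>x. -m < x \<Longrightarrow> x < 0 \<Longrightarrow> \<rho> x \<in> {rm..z} \<and> enthalpy Pm (\<rho> x) = enthalpy Pm rm - g * x"
    "\<And>x. 0 \<le> x \<Longrightarrow> x < l \<Longrightarrow> \<rho> x \<in> {z'..rp} \<and> enthalpy Pp (\<rho> x) = enthalpy Pp rp - g * x"
    by (rule rho0_bounds) blast
  show thesis
  proof (rule that[of "max z rp"])
    show "\<rho> x \<le> max z rp" if "x \<in> S" for x
      using that z(3)[of x] z(4)[of x] by (cases "x < 0") auto
  qed (use z(1) in simp)
qed

text \<open>On each side the prescribed enthalpy decreases in \<open>x\<close>, and so does the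
  density. The upward jump at the interface rules out one monotone piece, so two are glued.\<close>

lemma rho0_measurable: "\<rho> \<in> borel_measurable (lebesgue_on S)"
proof -
  have "antimono_on {-m<..<0} \<rho>"
  proof (rule monotone_onI)
    fix x y assume xy: "x \<in> {-m<..<0}" "y \<in> {-m<..<0}" "x \<le> y"
    have "g * x \<le> g * y"
      using xy(3) g_pos by simp
    then have "enthalpy Pm (\<rho> y) \<le> enthalpy Pm (\<rho> x)"
      using xy by (simp add: enthalpy_rho0)
    then show "\<rho> y \<le> \<rho> x"
      using enthalpy_le_iff[OF Pm rho0_pos rho0_pos, of y x] xy l_pos by simp
  qed
  moreover have "antimono_on {0..<l} \<rho>"
  proof (rule monotone_onI)
    fix x y assume xy: "x \<in> {0..<l}" "y \<in> {0..<l}" "x \<le> y"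
    have "g * x \<le> g * y"
      using xy(3) g_pos by simp
    then have "enthalpy Pp (\<rho> y) \<le> enthalpy Pp (\<rho> x)"
      using xy by (simp add: enthalpy_rho0)
    then show "\<rho> y \<le> \<rho> x"
      using enthalpy_le_iff[OF Pp rho0_pos rho0_pos, of y x] xy m_pos by simp
  qed
  ultimately have "(\<lambda>x. \<rho> x * indicator {-m<..<0} x + \<rho> x * indicator {0..<l} x) \<in> borel_measurable borel"
    by (intro borel_measurable_add antimono_on_times_indicator_measurable) simp_all
  also have "(\<lambda>x. \<rho> x * indicator {-m<..<0} x + \<rho> x * indicator {0..<l} x) = (\<lambda>x. if x \<in> S then \<rho> x else 0)"
    using m_pos l_pos by (intro ext) (auto simp: indicator_def)
  finally have "(\<lambda>x. if x \<in> S then \<rho> x else 0) \<in> borel_measurable lebesgue"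
    by (intro measurable_completion) simp
  then show ?thesis
    by (rule borel_measurable_if_D)
qed

text \<open>A change of density by \<open>e\<close> costs a positive amount of enthalpy, whereas the
  enthalpy changes only by \<open>g\<close> times the distance to the interface. Comparing the two
  yields \<delta> directly.\<close>

lemma rho0_near_interface:
  assumes e: "e > 0"
  obtains \<delta> where "\<delta> > 0" "\<And>x. x \<in> S \<Longrightarrow> -\<delta> < x \<Longrightarrow> x < 0 \<Longrightarrow> \<rho> x \<le> rm + e"
    "\<And>x. x \<in> S \<Longrightarrow> 0 \<le> x \<Longrightarrow> x < \<delta> \<Longrightarrow> \<rho> x \<ge> rp - e"
proof -
  \<comment> \<open>\<open>rp - e\<close> may fail to be positive and so leave the range where the
    enthalpy is monotone; the maximum with \<open>rp / 2\<close> keeps the comparison density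
    positive.\<close>
  define r where "r = max (rp - e) (rp / 2)"
  have r: "0 < r" "r < rp" "rp - e \<le> r"
    using e rp_pos by (auto simp: r_def)
  define a where "a = enthalpy Pm (rm + e) - enthalpy Pm rm"
  define b where "b = enthalpy Pp rp - enthalpy Pp r"
  have ab: "a > 0" "b > 0"
    using enthalpy_less_iff[OF Pm, of rm "rm + e"] enthalpy_less_iff[OF Pp, of r rp] rm_pos e r
    by (auto simp: a_def b_def)
  show thesis
  proof (rule that[of "min a b / g"])
    show "min a b / g > 0"
      using ab g_pos by simp
  next
    fix x assume x: "x \<in> S" "- (min a b / g) < x" "x < 0"
    have "- x * g < min a b"
      using pos_less_divide_eq[OF g_pos, of "- x" "min a b"] x(2) by linarith
    then have "enthalpy Pm (\<rho> x) < enthalpy Pm (rm + e)"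
      using x by (simp add: enthalpy_rho0 a_def algebra_simps)
    then show "\<rho> x \<le> rm + e"
      using enthalpy_less_iff[OF Pm rho0_pos[OF x(1)], of "rm + e"] rm_pos e by simp
  next
    fix x assume x: "x \<in> S" "0 \<le> x" "x < min a b / g"
    have "x * g < min a b"
      using pos_less_divide_eq[OF g_pos, of x "min a b"] x(3) by linarith
    then have "enthalpy Pp r < enthalpy Pp (\<rho> x)"
      using x by (simp add: enthalpy_rho0 b_def algebra_simps)
    then show "\<rho> x \<ge> rp - e"
      using enthalpy_less_iff[OF Pp r(1) rho0_pos[OF x(1)]] r by simp
  qed
qed

section \<open>Lower bound for the energy, and the eigenvalue as a square root\<close>

lemma dP_rho0_nonneg: "x \<in> S \<Longrightarrow> dP_rho0 Pm Pp g rm x \<ge> 0"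
  using rho0_pos pressure_law_D(2)[OF Pm] pressure_law_D(2)[OF Pp] by (simp add: dP_rho0_def)

text \<open>If the integrand of \<open>E\<close> is not integrable, then \<open>E = 0\<close> by convention and the bound holds trivially.\<close>

lemma energy_E_ge:
  assumes k: "k > 0" and J: "integrable (lebesgue_on S) (\<lambda>x. \<rho> x * ((\<phi> x)\<^sup>2 + (\<psi> x)\<^sup>2))"
  shows "energy_E Pm Pp g m l rm k \<phi> \<psi> \<ge> - (g * k * energy_J Pm Pp g m l rm \<phi> \<psi>)"
proof -
  let ?F = "\<lambda>x. dP_rho0 Pm Pp g rm x * \<rho> x * (weak_deriv S \<psi> x + k * \<phi> x)\<^sup>2 - 2 * g * \<rho> x * k * \<psi> x * \<phi> x"
  have "(LINT x|lebesgue_on S. - (g * k) * (\<rho> x * ((\<phi> x)\<^sup>2 + (\<psi> x)\<^sup>2))) \<le> (LINT x|lebesgue_on S. ?F x)"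
  proof (cases "integrable (lebesgue_on S) ?F")
    case True
    show ?thesis
    proof (rule integral_mono[OF _ True])
      show "integrable (lebesgue_on S) (\<lambda>x. - (g * k) * (\<rho> x * ((\<phi> x)\<^sup>2 + (\<psi> x)\<^sup>2)))"
        using J by (rule integrable_mult_right)
      fix x assume "x \<in> space (lebesgue_on S)"
      then have x: "x \<in> S" by simp
      have "0 \<le> dP_rho0 Pm Pp g rm x * \<rho> x * (weak_deriv S \<psi> x + k * \<phi> x)\<^sup>2"
        using dP_rho0_nonneg[OF x] rho0_pos[OF x] by simp
      \<comment> \<open>Completing the square absorbs the indefinite cross term into the density of
        \<open>J\<close>.\<close>
      moreover have "0 \<le> g * k * \<rho> x * (\<phi> x - \<psi> x)\<^sup>2"
        using g_pos k rho0_pos[OF x] by simp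
      ultimately show "- (g * k) * (\<rho> x * ((\<phi> x)\<^sup>2 + (\<psi> x)\<^sup>2)) \<le> ?F x"
        by (simp add: power2_eq_square algebra_simps)
    qed
  next
    case False
    have "0 \<le> (LINT x|lebesgue_on S. \<rho> x * ((\<phi> x)\<^sup>2 + (\<psi> x)\<^sup>2))"
    proof (rule Bochner_Integration.integral_nonneg)
      fix x assume "x \<in> space (lebesgue_on S)"
      then show "0 \<le> \<rho> x * ((\<phi> x)\<^sup>2 + (\<psi> x)\<^sup>2)"
        using rho0_pos[of x] by simp
    qed
    then show ?thesis
      using False g_pos k by (simp add: not_integrable_integral_eq)
  qed
  then show ?thesis
    by (simp add: energy_E_def energy_J_def)
qed

text \<open>The constraint \<open>J = 1\<close> forces integrability, since a non-integrable
  integrand would give \<open>J = 0\<close> by convention.\<close>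

lemma admissible_energy_E_ge:
  assumes k: "k > 0" and adm: "(\<phi>, \<psi>) \<in> admissible Pm Pp g m l rm"
  shows "energy_E Pm Pp g m l rm k \<phi> \<psi> \<ge> - (g * k)"
proof -
  have J: "energy_J Pm Pp g m l rm \<phi> \<psi> = 1"
    using adm by (simp add: admissible_def)
  have "integrable (lebesgue_on S) (\<lambda>x. \<rho> x * ((\<phi> x)\<^sup>2 + (\<psi> x)\<^sup>2))"
  proof (rule ccontr)
    assume "\<not> ?thesis"
    then have "energy_J Pm Pp g m l rm \<phi> \<psi> = 0"
      unfolding energy_J_def by (subst not_integrable_integral_eq) simp_all
    with J show False by simp
  qed
  then show ?thesis
    using energy_E_ge[OF k, of \<phi> \<psi>] J by simp
qed

text \<open>The lower bound \<open>- (g * k)\<close> makes the real infimum \<open>I\<close>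
  genuine. The trial pair makes it negative, so \<open>sqrt (- I)\<close> is the unique positive
  number that \<open>THE\<close> can pick.\<close>

lemma eigenvalue_ge:
  assumes k: "k > 0" and adm: "(\<phi>, \<psi>) \<in> admissible Pm Pp g m l rm"
    and E: "energy_E Pm Pp g m l rm k \<phi> \<psi> \<le> - c" and c: "c > 0"
  shows "(eigenvalue Pm Pp g m l rm k)\<^sup>2 \<ge> c"
proof -
  define I where "I = (INF (\<phi>, \<psi>) \<in> admissible Pm Pp g m l rm. energy_E Pm Pp g m l rm k \<phi> \<psi>)"
  have "bdd_below ((\<lambda>(\<phi>, \<psi>). energy_E Pm Pp g m l rm k \<phi> \<psi>) ` admissible Pm Pp g m l rm)"
    using admissible_energy_E_ge[OF k] by (intro bdd_belowI2[of _ "- (g * k)"]) auto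
  then have "I \<le> energy_E Pm Pp g m l rm k \<phi> \<psi>"
    using cINF_lower[OF _ adm, of "\<lambda>(\<phi>, \<psi>). energy_E Pm Pp g m l rm k \<phi> \<psi>"] by (simp add: I_def)
  with E have I: "I \<le> - c" by simp
  have "eigenvalue Pm Pp g m l rm k = sqrt (- I)"
    unfolding eigenvalue_def I_def[symmetric]
  proof (rule the_equality)
    show "sqrt (- I) > 0 \<and> - (sqrt (- I))\<^sup>2 = I"
      using I c by simp
    show "lam = sqrt (- I)" if "lam > 0 \<and> - lam\<^sup>2 = I" for lam
      using that by (auto simp: real_sqrt_unique)
  qed
  with I c show ?thesis
    by simp
qed

section \<open>Upper bound for the infimum from rescaled bumps\<close>

lemma energy_E_test_function:
  assumes \<eta>: "\<eta> \<in> test_functions S" and k: "k \<noteq> 0"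
  shows "energy_E Pm Pp g m l rm k (\<lambda>x. - (deriv \<eta> x / k)) \<eta> = g * (LINT x|lebesgue_on S. \<rho> x * (\<eta> x * deriv \<eta> x))"
proof -
  note smooth = test_function_D(1)[OF \<eta>]
  have "(\<lambda>x. 2 * g * (\<rho> x * (\<eta> x * deriv \<eta> x))) \<in> borel_measurable (lebesgue_on S)"
    using rho0_measurable continuous_L1_loc[OF C_infinity_on_UNIV_D(2)[OF smooth], of S]
      continuous_L1_loc[OF C_infinity_on_UNIV_D(3)[OF smooth], of S]
    by (auto simp: L1_loc_def)
  then have "(LINT x|lebesgue_on S.
        dP_rho0 Pm Pp g rm x * \<rho> x * (weak_deriv S \<eta> x + k * - (deriv \<eta> x / k))\<^sup>2
        - 2 * g * \<rho> x * k * \<eta> x * - (deriv \<eta> x / k))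
      = (LINT x|lebesgue_on S. 2 * g * (\<rho> x * (\<eta> x * deriv \<eta> x)))"
  proof (rule integral_lebesgue_on_cong_AE[rotated])
    \<comment> \<open>Where the weak and classical derivatives agree, the choice of the first
      component makes the squared term vanish.\<close>
    show "AE x in lebesgue_on S.
        dP_rho0 Pm Pp g rm x * \<rho> x * (weak_deriv S \<eta> x + k * - (deriv \<eta> x / k))\<^sup>2
        - 2 * g * \<rho> x * k * \<eta> x * - (deriv \<eta> x / k) = 2 * g * (\<rho> x * (\<eta> x * deriv \<eta> x))"
      using weak_deriv_C_infinity[OF smooth, of "-m" l] by eventually_elim (use k in simp)
  qed simp
  then show ?thesis
    unfolding energy_E_def by simp
qed

text \<open>The weight is nonnegative below the interface and nonpositive above it, so replacing the
  density by \<open>A\<close> below and \<open>B\<close> above can only raise the integral. The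
  resulting step function is integrated exactly, the weight being the derivative of
  \<open>(bump (k * x))\<^sup>2 / (2 * k)\<close>.\<close>

lemma integral_rho0_bump_le:
  assumes k: "k > 0" "1 / k \<le> m" "1 / k \<le> l"
    and lower: "\<And>x. x \<in> S \<Longrightarrow> - (1 / k) < x \<Longrightarrow> x < 0 \<Longrightarrow> \<rho> x \<le> A"
    and upper: "\<And>x. x \<in> S \<Longrightarrow> 0 \<le> x \<Longrightarrow> x < 1 / k \<Longrightarrow> \<rho> x \<ge> B"
    and int: "integrable (lebesgue_on S) (\<lambda>x. \<rho> x * (bump (k * x) * deriv bump (k * x)))"
  shows "(LINT x|lebesgue_on S. \<rho> x * (bump (k * x) * deriv bump (k * x))) \<le> - ((B - A) * (bump 0)\<^sup>2 / (2 * k))"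
proof -
  let ?w = "\<lambda>x. bump (k * x) * deriv bump (k * x)"
  define r where "r x = (if x < 0 then A else B)" for x :: real
  have km: "k * m \<ge> 1" "k * l \<ge> 1"
    using k by (simp_all add: field_simps)
  \<comment> \<open>At 0 the step function has the upper value \<open>B\<close>; since the weight
    vanishes there, the primitive with \<open>A\<close> still works on the closed lower
    interval.\<close>
  have w0: "?w 0 = 0"
    using deriv_bump_nonneg[of 0] deriv_bump_nonpos[of 0] by simp
  have F: "((\<lambda>x. C * (bump (k * x))\<^sup>2 / (2 * k)) has_real_derivative C * ?w x) (at x)" for C x
  proof -
    have "((\<lambda>x. C * (1 * bump (k * x))\<^sup>2 / (2 * k)) has_real_derivative
        C * (2 * (1 * (k * deriv bump (k * x))) * (1 * bump (k * x))) / (2 * k)) (at x)"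
      by (intro DERIV_cdivide DERIV_cmult) (use DERIV_power[OF bump_scaled_has_derivative[of 1 k x], of 2] in \<open>simp add: mult.assoc\<close>)
    then show ?thesis
      using k by (simp add: field_simps)
  qed
  have "((\<lambda>x. r x * ?w x) has_integral A * (bump (k * 0))\<^sup>2 / (2 * k) - A * (bump (k * - m))\<^sup>2 / (2 * k)) {-m..0}"
  proof (rule fundamental_theorem_of_calculus)
    fix x assume "x \<in> {-m..0}"
    then have "r x * ?w x = A * ?w x"
      using w0 by (cases "x = 0") (auto simp: r_def)
    then show "((\<lambda>x. A * (bump (k * x))\<^sup>2 / (2 * k)) has_vector_derivative r x * ?w x) (at x within {-m..0})"
      using has_field_derivative_at_within[OF F[of A x]]
      by (simp only: has_real_derivative_iff_has_vector_derivative)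
  qed (use m_pos in simp)
  moreover have "((\<lambda>x. r x * ?w x) has_integral B * (bump (k * l))\<^sup>2 / (2 * k) - B * (bump (k * 0))\<^sup>2 / (2 * k)) {0..l}"
  proof (rule fundamental_theorem_of_calculus)
    fix x assume "x \<in> {0..l}"
    then have "r x * ?w x = B * ?w x"
      by (simp add: r_def)
    then show "((\<lambda>x. B * (bump (k * x))\<^sup>2 / (2 * k)) has_vector_derivative r x * ?w x) (at x within {0..l})"
      using has_field_derivative_at_within[OF F[of B x]]
      by (simp only: has_real_derivative_iff_has_vector_derivative)
  qed (use l_pos in simp)
  ultimately have "((\<lambda>x. r x * ?w x) has_integral
      A * (bump (k * 0))\<^sup>2 / (2 * k) - A * (bump (k * - m))\<^sup>2 / (2 * k) +
      (B * (bump (k * l))\<^sup>2 / (2 * k) - B * (bump (k * 0))\<^sup>2 / (2 * k))) {-m..l}"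
    using m_pos l_pos by (intro has_integral_combine[where c = 0]) simp_all
  \<comment> \<open>The support fits between the walls, so only the interface contributes.\<close>
  moreover have "bump (k * - m) = 0" "bump (k * l) = 0"
    using km by (simp_all add: bump_eq_0)
  ultimately have "((\<lambda>x. r x * ?w x) has_integral - ((B - A) * (bump 0)\<^sup>2 / (2 * k))) {-m..l}"
    by (simp add: diff_divide_distrib left_diff_distrib)
  then have I: "integral S (\<lambda>x. r x * ?w x) = - ((B - A) * (bump 0)\<^sup>2 / (2 * k))"
    by (simp add: has_integral_Icc_iff_Ioo integral_unique)
  obtain M where M: "M > 0" "\<And>y. \<bar>deriv bump y\<bar> \<le> M"
    by (rule deriv_bump_bounded) blast
  have r_int: "integrable (lebesgue_on S) (\<lambda>x. r x * ?w x)"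
  proof (rule integrable_lebesgue_on_bounded)
    have "r \<in> borel_measurable borel"
      unfolding r_def[abs_def] by measurable
    then have "r \<in> borel_measurable (lebesgue_on S)"
      by (intro measurable_restrict_space1 measurable_completion) simp
    then show "(\<lambda>x. r x * ?w x) \<in> borel_measurable (lebesgue_on S)"
      by (intro borel_measurable_times continuous_comp_scale_measurable bump_continuous deriv_bump_continuous)
    fix x
    have "\<bar>r x\<bar> * (\<bar>bump (k * x)\<bar> * \<bar>deriv bump (k * x)\<bar>) \<le> (\<bar>A\<bar> + \<bar>B\<bar>) * (1 * M)"
      using M hump_bounds[of 1 "-1" 1 "k * x"] by (intro mult_mono) (auto simp: r_def)
    then show "\<bar>r x * ?w x\<bar> \<le> (\<bar>A\<bar> + \<bar>B\<bar>) * (1 * M)"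
      by (simp add: abs_mult)
  qed
  have "(LINT x|lebesgue_on S. \<rho> x * ?w x) \<le> (LINT x|lebesgue_on S. r x * ?w x)"
  proof (rule integral_mono[OF int r_int])
    fix x assume "x \<in> space (lebesgue_on S)"
    then have x: "x \<in> S" by simp
    show "\<rho> x * ?w x \<le> r x * ?w x"
    proof (cases "\<bar>k * x\<bar> \<ge> 1")
      case True
      then show ?thesis by (simp add: bump_eq_0)
    next
      case False
      then have "\<bar>x\<bar> < 1 / k"
        using k(1) by (simp add: abs_mult field_simps)
      then have x': "- (1 / k) < x" "x < 1 / k" by simp_all
      show ?thesis
      proof (cases "x < 0")
        case True
        have "?w x \<ge> 0"
          using True k(1) by (intro mult_nonneg_nonneg hump_bounds deriv_bump_nonneg) (simp add: mult_le_0_iff)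
        then show ?thesis
          using lower[OF x x'(1) True] True by (simp add: r_def mult_right_mono)
      next
        case False
        have "?w x \<le> 0"
          using False k(1) by (intro mult_nonneg_nonpos hump_bounds deriv_bump_nonpos) simp
        then show ?thesis
          using upper[OF x _ x'(2)] False by (simp add: r_def mult_right_mono_neg)
      qed
    qed
  qed
  also have "\<dots> = integral S (\<lambda>x. r x * ?w x)"
    by (rule lebesgue_integral_eq_integral[OF r_int]) simp
  finally show ?thesis
    using I by simp
qed

text \<open>Before normalisation the rescaled bump has energy at most \<open>- (g * D)\<close> and
  \<open>J\<close> at most \<open>B / k\<close>; the quotient gives the slope
  \<open>g * D / B\<close>.\<close>

lemma eigenvalue_linear_growth:
  "\<exists>C0 C1. C0 > 0 \<and> C1 > 0 \<and> (\<forall>k\<ge>C0. (eigenvalue Pm Pp g m l rm k)\<^sup>2 \<ge> C1 * k)"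
proof -
  \<comment> \<open>With a quarter of the jump as margin on each side, half of it,
    \<open>2 * e\<close>, remains in the energy estimate.\<close>
  define e where "e = (rp - rm) / 4"
  have e: "e > 0"
    using rp_gt by (simp add: e_def)
  obtain \<delta> where \<delta>: "\<delta> > 0" "\<And>x. x \<in> S \<Longrightarrow> -\<delta> < x \<Longrightarrow> x < 0 \<Longrightarrow> \<rho> x \<le> rm + e"
    "\<And>x. x \<in> S \<Longrightarrow> 0 \<le> x \<Longrightarrow> x < \<delta> \<Longrightarrow> \<rho> x \<ge> rp - e"
    by (rule rho0_near_interface[OF e]) blast
  obtain R where R: "R > 0" "\<And>x. x \<in> S \<Longrightarrow> \<rho> x \<le> R"
    by (rule rho0_bounded) blast
  obtain M where M: "M > 0" "\<And>y. \<bar>deriv bump y\<bar> \<le> M"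
    by (rule deriv_bump_bounded) blast
  define D where "D = e * (bump 0)\<^sup>2"
  \<comment> \<open>Bounds the density of \<open>J\<close>: \<open>R\<close> for the fluid density,
    \<open>M\<^sup>2\<close> for the derivative and 1 for the bump. The support length
    \<open>2 / k\<close> and the factor one half in \<open>J\<close> then give
    \<open>B / k\<close>.\<close>
  define B where "B = R * (M\<^sup>2 + 1)"
  have D: "D > 0" and B: "B > 0"
    using e bump_0_pos R(1) M(1) by (auto simp: D_def B_def intro!: mult_pos_pos add_nonneg_pos)
  \<comment> \<open>The first entry confines the bump to the region where the density is near its
    one-sided limits. The factor 2 in the others makes \<open>1 / k\<close> strictly smaller than
    \<open>m\<close> and \<open>l\<close>, so the closed support lies in the open interval.\<close>
  define C0 where "C0 = max (1 / \<delta>) (max (2 / m) (2 / l))"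
  have bound: "(eigenvalue Pm Pp g m l rm k)\<^sup>2 \<ge> g * D / B * k" if k: "k \<ge> C0" for k
  proof -
    have "0 < 1 / \<delta>"
      using \<delta>(1) by simp
    also have "\<dots> \<le> k"
      using k by (simp add: C0_def)
    finally have k_pos: "k > 0" .
    have small: "1 / k \<le> \<delta>" "1 / k < m" "1 / k < l"
      using k k_pos \<delta>(1) m_pos l_pos by (auto simp: C0_def field_simps)
    let ?w = "\<lambda>x. bump (k * x) * deriv bump (k * x)"
    let ?J = "\<lambda>x. \<rho> x * ((- deriv bump (k * x))\<^sup>2 + (bump (k * x))\<^sup>2)"
    note meas = rho0_measurable continuous_comp_scale_measurable[OF bump_continuous, of k S]
      continuous_comp_scale_measurable[OF deriv_bump_continuous, of k S]
    have w_int: "integrable (lebesgue_on S) (\<lambda>x. \<rho> x * ?w x)"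
    proof (rule integrable_lebesgue_on_bounded)
      show "(\<lambda>x. \<rho> x * ?w x) \<in> borel_measurable (lebesgue_on S)"
        by (intro borel_measurable_times meas)
      fix x assume x: "x \<in> S"
      have "\<bar>\<rho> x\<bar> * (\<bar>bump (k * x)\<bar> * \<bar>deriv bump (k * x)\<bar>) \<le> R * (1 * M)"
        using M hump_bounds[of 1 "-1" 1 "k * x"] R(1) R(2)[OF x] rho0_pos[OF x] by (intro mult_mono) auto
      then show "\<bar>\<rho> x * ?w x\<bar> \<le> R * (1 * M)"
        by (simp add: abs_mult)
    qed
    have J_le: "?J x \<le> B * indicator {- (1 / k)<..<1 / k} x" if x: "x \<in> S" for x
    proof (cases "\<bar>k * x\<bar> < 1")
      case True
      have "(deriv bump (k * x))\<^sup>2 \<le> M\<^sup>2"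
        using power_mono[OF M(2), of "k * x" 2] by simp
      moreover have "(bump (k * x))\<^sup>2 \<le> 1"
        using hump_bounds[of 1 "-1" 1 "k * x"] by (simp add: power_le_one)
      ultimately have "?J x \<le> R * (M\<^sup>2 + 1)"
        using R(1) R(2)[OF x] by (intro mult_mono) auto
      moreover have "x \<in> {- (1 / k)<..<1 / k}"
        using True k_pos by (simp add: abs_less_iff field_simps)
      ultimately show ?thesis
        by (simp add: B_def)
    next
      case False
      then have "bump (k * x) = 0" "deriv bump (k * x) = 0"
        by (simp_all add: bump_eq_0 deriv_bump)
      then show ?thesis
        using B by simp
    qed
    have J_int: "integrable (lebesgue_on S) ?J"
    proof (rule integrable_lebesgue_on_bounded)
      show "?J \<in> borel_measurable (lebesgue_on S)"
        by (intro borel_measurable_times borel_measurable_add borel_measurable_power borel_measurable_uminus meas)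
      fix x assume x: "x \<in> S"
      have "?J x \<ge> 0"
        using rho0_pos[OF x] by simp
      moreover have "?J x \<le> B"
        using B by (intro order_trans[OF J_le[OF x]]) (simp split: split_indicator)
      ultimately show "\<bar>?J x\<bar> \<le> B"
        by simp
    qed
    define J1 where "J1 = energy_J Pm Pp g m l rm (\<lambda>x. - deriv bump (k * x)) (\<lambda>x. bump (k * x))"
    have J1_le: "J1 \<le> B / k"
    proof -
      have sub: "{- (1 / k)<..<1 / k} \<subseteq> S"
        using small by auto
      have ind: "(\<lambda>x. indicator S x *\<^sub>R (B * indicator {- (1 / k)<..<1 / k} x))
          = (\<lambda>x. B * indicator {- (1 / k)<..<1 / k} x)"
        using sub by (intro ext) (auto simp: indicator_def)
      have "integrable lebesgue (\<lambda>x. B * indicator {- (1 / k)<..<1 / k} x)"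
        using k_pos by (intro integrable_mult_right integrable_real_indicator) simp_all
      then have "integrable (lebesgue_on S) (\<lambda>x. B * indicator {- (1 / k)<..<1 / k} x)"
        by (subst integrable_restrict_space) (simp, simp only: ind)
      then have "(LINT x|lebesgue_on S. ?J x) \<le> (LINT x|lebesgue_on S. B * indicator {- (1 / k)<..<1 / k} x)"
        using J_le by (intro integral_mono[OF J_int]) simp_all
      also have "\<dots> = (LINT x|lebesgue. B * indicator {- (1 / k)<..<1 / k} x)"
        by (subst integral_restrict_space) (simp, simp only: ind)
      also have "\<dots> = B * (2 / k)"
        using k_pos by simp
      finally show ?thesis
        by (simp add: J1_def energy_J_def)
    qed
    define I where "I = (LINT x|lebesgue_on S. \<rho> x * ?w x)"
    have "I \<le> - ((rp - e - (rm + e)) * (bump 0)\<^sup>2 / (2 * k))"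
      unfolding I_def
    proof (rule integral_rho0_bump_le[OF k_pos _ _ _ _ w_int])
      show "\<rho> x \<le> rm + e" if "x \<in> S" "- (1 / k) < x" "x < 0" for x
        using \<delta>(2)[OF that(1) _ that(3)] that(2) small(1) by simp
      show "\<rho> x \<ge> rp - e" if "x \<in> S" "0 \<le> x" "x < 1 / k" for x
        using \<delta>(3)[OF that(1,2)] that(3) small(1) by simp
    qed (use small in simp_all)
    also have "(rp - e - (rm + e)) * (bump 0)\<^sup>2 / (2 * k) = D / k"
      using k_pos by (simp add: D_def e_def field_simps)
    finally have I: "I \<le> - (D / k)" .
    have test: "(\<lambda>x. c * bump (k * x)) \<in> test_functions S" for c
      using small by (intro bump_scaled_test_function[OF k_pos]) auto
    have deriv: "deriv (\<lambda>x. c * bump (k * x)) = (\<lambda>x. c * (k * deriv bump (k * x)))" for c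
      by (intro ext DERIV_imp_deriv bump_scaled_has_derivative)
    \<comment> \<open>The amplitude is kept free: 1 is used to show that \<open>J1\<close> is
      positive, and the normalising value in the final estimate.\<close>
    have E: "energy_E Pm Pp g m l rm k (\<lambda>x. c * - deriv bump (k * x)) (\<lambda>x. c * bump (k * x)) = c\<^sup>2 * (g * k * I)" for c
    proof -
      have "energy_E Pm Pp g m l rm k (\<lambda>x. c * - deriv bump (k * x)) (\<lambda>x. c * bump (k * x))
          = energy_E Pm Pp g m l rm k (\<lambda>x. - (deriv (\<lambda>x. c * bump (k * x)) x / k)) (\<lambda>x. c * bump (k * x))"
        using k_pos by (simp add: deriv)
      also have "\<dots> = g * (LINT x|lebesgue_on S. \<rho> x * (c * bump (k * x) * (c * (k * deriv bump (k * x)))))"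
        using k_pos by (subst energy_E_test_function[OF test]) (simp_all add: deriv)
      also have "(\<lambda>x. \<rho> x * (c * bump (k * x) * (c * (k * deriv bump (k * x))))) = (\<lambda>x. (c\<^sup>2 * k) * (\<rho> x * ?w x))"
        by (simp add: power2_eq_square algebra_simps)
      finally show ?thesis
        by (simp add: I_def)
    qed
    have gkI: "g * k * I \<le> - (g * D)"
      using mult_left_mono[OF I, of "g * k"] g_pos k_pos by simp
    txt \<open>The general bound \<open>E \<ge> - g k J\<close> turns \<open>E < 0\<close> into \<open>J > 0\<close>.\<close>
    have "- (g * k * J1) \<le> g * k * I"
      using energy_E_ge[OF k_pos J_int] E[of 1] by (simp add: J1_def)
    with gkI have "0 < g * k * J1"
      using g_pos D by (smt (verit) mult_pos_pos)
    then have J1: "J1 > 0"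
      using g_pos k_pos zero_less_mult_pos[of "g * k" J1] mult_pos_pos[of g k] by blast
    \<comment> \<open>\<open>J\<close> is quadratic in the pair, so this amplitude achieves
      \<open>J = 1\<close>.\<close>
    define c where "c = 1 / sqrt J1"
    have c2: "c\<^sup>2 = 1 / J1"
      using J1 by (simp add: c_def power_divide)
    have "energy_J Pm Pp g m l rm (\<lambda>x. c * - deriv bump (k * x)) (\<lambda>x. c * bump (k * x)) = c\<^sup>2 * J1"
    proof -
      have "(\<lambda>x. \<rho> x * ((c * - deriv bump (k * x))\<^sup>2 + (c * bump (k * x))\<^sup>2)) = (\<lambda>x. c\<^sup>2 * ?J x)"
        by (simp add: power_mult_distrib algebra_simps)
      then show ?thesis
        by (simp add: energy_J_def J1_def)
    qed
    moreover have "(\<lambda>x. c * - deriv bump (k * x)) \<in> L2 S"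
      by (intro continuous_L2 continuous_intros continuous_on_compose2[OF deriv_bump_continuous]) auto
    ultimately have adm: "(\<lambda>x. c * - deriv bump (k * x), \<lambda>x. c * bump (k * x)) \<in> admissible Pm Pp g m l rm"
      using test_function_H1_0[OF test] J1 c2 by (simp add: admissible_def)
    show ?thesis
    proof (rule eigenvalue_ge[OF k_pos adm])
      show "g * D / B * k > 0"
        using g_pos D B k_pos by simp
      have "g * D / B * k = g * D / (B / k)"
        using k_pos by simp
      also have "\<dots> \<le> g * D / J1"
        using J1 J1_le g_pos D B k_pos by (intro divide_left_mono) auto
      finally have "- (g * D) / J1 \<le> - (g * D / B * k)"
        by simp
      moreover have "g * k * I / J1 \<le> - (g * D) / J1"
        using gkI J1 by (intro divide_right_mono) auto
      ultimately show "energy_E Pm Pp g m l rm k (\<lambda>x. c * - deriv bump (k * x)) (\<lambda>x. c * bump (k * x)) \<le> - (g * D / B * k)"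
        unfolding E c2 by simp
    qed
  qed
  have "C0 > 0"
    using \<delta>(1) by (simp add: C0_def less_max_iff_disj)
  moreover have "g * D / B > 0"
    using g_pos D B by simp
  ultimately show ?thesis
    using bound by blast
qed

end

theorem lemma3p5:
  fixes Pm Pp :: "real \<Rightarrow> real" and g m l rm :: real
  assumes "g > 0" and "m > 0" and "l > 0"
    and "pressure_law Pm" and "pressure_law Pp"
    and "rm > 0" and "Pm rm > Pp rm" and "Pm rm \<in> Pp ` {0<..}"
    and "enthalpy Pm rm + g * m \<in> enthalpy Pm ` {0<..}"
    and "enthalpy Pp (rho_plus Pm Pp rm) - g * l \<in> enthalpy Pp ` {0<..}"
  shows "\<exists>C0 C1 C2. C0 > 0 \<and> C1 > 0 \<and> C2 > 0 \<and>
    (\<forall>k\<ge>C0. (eigenvalue Pm Pp g m l rm k)\<^sup>2 \<ge> C1 * k - C2)"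
proof -
  interpret steady_state Pm Pp g m l rm
    using assms by unfold_locales
  obtain C0 C1 where C: "C0 > 0" "C1 > 0" "\<forall>k\<ge>C0. (eigenvalue Pm Pp g m l rm k)\<^sup>2 \<ge> C1 * k"
    using eigenvalue_linear_growth by blast
  \<comment> \<open>The linear bound holds with nothing subtracted, so any positive
    \<open>C2\<close> serves; 1 is taken.\<close>
  have "(eigenvalue Pm Pp g m l rm k)\<^sup>2 \<ge> C1 * k - 1" if "k \<ge> C0" for k
    using C(3) that by fastforce
  with C(1,2) show ?thesis
    by (intro exI[of _ C0] exI[of _ C1] exI[of _ 1]) simp
qed

end
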